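(* Let $\alpha^+,\lambda^+,\alpha^-,\lambda^-\in(0,\infty)$ and $\beta^+,\beta^-\in[0,1)$, let $X$ be a random variable with $X\sim\mathrm{TS}(\alpha^+,\beta^+,\lambda^+;\alpha^-,\beta^-,\lambda^-)$, and set $\mu:=\mathbb{E}[X]$ and $\sigma^2:=\mathrm{Var}[X]$ (with $\sigma>0$). Then $$\sup_{x\in\mathbb{R}}|G_X(x)-\Phi_{\mu,\sigma^2}(x)|\le32c\bigg[(1-\beta^+)(2-\beta^+)\frac{(1-\beta^-)\mu/\sigma^3+\lambda^-/\sigma}{\lambda^+((1-\beta^-)\lambda^++(1-\beta^+)\lambda^-)}+(1-\beta^-)(2-\beta^-)\frac{(\beta^+-1)\mu/\sigma^3+\lambda^+/\sigma}{\lambda^-((1-\beta^-)\lambda^++(1-\beta^+)\lambda^-)}\bigg].$$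
   Context: For $\alpha^+,\lambda^+,\alpha^-,\lambda^-\in(0,\infty)$ and $\beta^+,\beta^-\in[0,1)$, the tempered stable distribution $\mathrm{TS}(\alpha^+,\beta^+,\lambda^+;\alpha^-,\beta^-,\lambda^-)$ is the infinitely divisible distribution on $\mathbb{R}$ with characteristic function $\varphi(z)=\exp\big(\int_{\mathbb{R}}(e^{izx}-1)F(dx)\big)$, $z\in\mathbb{R}$, where $$F(dx)=\Big(\frac{\alpha^+}{x^{1+\beta^+}}e^{-\lambda^+x}\mathbf{1}_{(0,\infty)}(x)+\frac{\alpha^-}{|x|^{1+\beta^-}}e^{-\lambda^-|x|}\mathbf{1}_{(-\infty,0)}(x)\Big)dx.$$ $G_X$ denotes the distribution function of $X$, and $\Phi_{\mu,\sigma^2}$ the distribution function of the normal distribution $N(\mu,\sigma^2)$. The number $c>0$ denotes the constant from the Berry--Esseen theorem, i.e. a constant such that for every i.i.d. sequence $(Y_j)_{j\in\mathbb{N}}$ with mean $m$, variance $s^2>0$ and $\mathbb{E}[|Y_1-m|^3]<\infty$ and every $n\in\mathbb{N}$, the distribution function of $(Y_1+\dots+Y_n-nm)/(s\sqrt n)$ differs from $\Phi_{0,1}$ in supremum norm by at most $c\,\mathbb{E}[|Y_1-m|^3]/(s^3\sqrt n)$. *)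

theory Defs
  imports "HOL-Probability.Probability"
begin

definition infinitely_divisible :: "real measure \<Rightarrow> bool" where
  "infinitely_divisible \<mu> \<longleftrightarrow>
     (\<forall>n::nat. n > 0 \<longrightarrow> (\<exists>\<nu>. real_distribution \<nu> \<and>
        distr (\<Pi>\<^sub>M i\<in>{..<n}. \<nu>) borel (\<lambda>\<omega>. \<Sum>i<n. \<omega> i) = \<mu>))"

definition ts_levy_density ::
  "real \<Rightarrow> real \<Rightarrow> real \<Rightarrow> real \<Rightarrow> real \<Rightarrow> real \<Rightarrow> real \<Rightarrow> real" where
  "ts_levy_density \<alpha>_p \<beta>_p lam_p \<alpha>_m \<beta>_m lam_m x =
     \<alpha>_p / x powr (1 + \<beta>_p) * exp (- lam_p * x) * indicator {0<..} x
   + \<alpha>_m / \<bar>x\<bar> powr (1 + \<beta>_m) * exp (- lam_m * \<bar>x\<bar>) * indicator {..<0} x"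

definition ts_levy_measure ::
  "real \<Rightarrow> real \<Rightarrow> real \<Rightarrow> real \<Rightarrow> real \<Rightarrow> real \<Rightarrow> real measure" where
  "ts_levy_measure \<alpha>_p \<beta>_p lam_p \<alpha>_m \<beta>_m lam_m =
     density lborel (\<lambda>x. ennreal (ts_levy_density \<alpha>_p \<beta>_p lam_p \<alpha>_m \<beta>_m lam_m x))"

text \<open>The suffixes \<open>_p\<close> and \<open>_m\<close> mark the parameters of the positive and the negative half-line.
  The law is determined by its characteristic function, so being the tempered stable
  distribution is expressed as a predicate on measures. It is meant for
  \<open>\<alpha>_p, lam_p, \<alpha>_m, lam_m > 0\<close> and \<open>\<beta>_p, \<beta>_m \<in> [0, 1)\<close>; then \<open>iexp (z * x) - 1\<close>
  is integrable with respect to the Levy measure, although that measure is infinite.\<close>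

definition is_tempered_stable ::
  "real \<Rightarrow> real \<Rightarrow> real \<Rightarrow> real \<Rightarrow> real \<Rightarrow> real \<Rightarrow> real measure \<Rightarrow> bool" where
  "is_tempered_stable \<alpha>_p \<beta>_p lam_p \<alpha>_m \<beta>_m lam_m \<mu> \<longleftrightarrow>
     real_distribution \<mu> \<and> infinitely_divisible \<mu> \<and>
     (\<forall>z. char \<mu> z =
        exp (CLINT x | ts_levy_measure \<alpha>_p \<beta>_p lam_p \<alpha>_m \<beta>_m lam_m. iexp (z * x) - 1))"

definition normal_cdf :: "real \<Rightarrow> real \<Rightarrow> real \<Rightarrow> real" where
  "normal_cdf m v = cdf (density lborel (\<lambda>x. ennreal (normal_density m (sqrt v) x)))"

text \<open>HOL cannot quantify over the type of the underlying probability space. Spaces on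
  \<open>nat \<Rightarrow> real\<close> suffice: every i.i.d. sequence has the same joint law as the coordinates on
  the corresponding product space. Integrability of \<open>\<bar>Y 0 - m\<bar>^3\<close> also makes the mean
  and the variance genuine integrals (a non-integrable \<open>Y 0\<close> would get \<open>m = 0\<close>, and
  \<open>\<bar>Y 0\<bar>^3\<close> would then not be integrable).\<close>

definition berry_esseen_constant :: "real \<Rightarrow> bool" where
  "berry_esseen_constant c \<longleftrightarrow> c > 0 \<and>
     (\<forall>(N :: (nat \<Rightarrow> real) measure) (Y :: nat \<Rightarrow> (nat \<Rightarrow> real) \<Rightarrow> real) m s.
        prob_space N \<longrightarrow>
        prob_space.indep_vars N (\<lambda>_. borel) Y UNIV \<longrightarrow>
        (\<forall>j. distr N borel (Y j) = distr N borel (Y 0)) \<longrightarrow>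
        m = prob_space.expectation N (Y 0) \<longrightarrow>
        s\<^sup>2 = prob_space.variance N (Y 0) \<longrightarrow>
        s > 0 \<longrightarrow>
        integrable N (\<lambda>\<omega>. \<bar>Y 0 \<omega> - m\<bar> ^ 3) \<longrightarrow>
        (\<forall>n::nat. n > 0 \<longrightarrow>
           (SUP x. \<bar>cdf (distr N borel (\<lambda>\<omega>. ((\<Sum>j<n. Y j \<omega>) - real n * m) / (s * sqrt (real n)))) x
                    - normal_cdf 0 1 x\<bar>)
           \<le> c * prob_space.expectation N (\<lambda>\<omega>. \<bar>Y 0 \<omega> - m\<bar> ^ 3) / (s ^ 3 * sqrt (real n))))"

end

theory Submission
  imports Defs
begin

text \<open>Write \<open>X\<close> as a sum of \<open>n\<close> i.i.d. copies of \<open>Y\<close>, where \<open>Y\<close> has characteristic exponent \<open>1/n\<close>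
  times that of \<open>X\<close>. Berry-Esseen bounds the distance by \<open>c n E\<bar>Y - E Y\<bar>\<^sup>3 / \<sigma>\<^sup>3\<close>, so it suffices
  to control \<open>n E\<bar>Y - E Y\<bar>\<^sup>3\<close> as \<open>n\<close> tends to infinity. By Jensen, \<open>E\<bar>Y - E Y\<bar>\<^sup>3 \<le> E\<bar>Z\<bar>\<^sup>3\<close> for the
  symmetrization \<open>Z = Y - Y'\<close>, whose characteristic function is \<open>exp (- g/n)\<close> with
  \<open>g t = \<integral> 2 (1 - cos (t x)) F(dx)\<close>. Both \<open>E\<bar>Z\<bar>\<^sup>3\<close> and \<open>\<integral>\<bar>x\<bar>\<^sup>3 F(dx)\<close> are read off from cosine transforms by
  \<open>\<bar>x\<bar>\<^sup>3 = const \<cdot> \<integral> (cos (t x) - 1 + (t x)\<^sup>2/2) / t\<^sup>4 dt\<close>, and \<open>exp (- u) \<le> 1 - u + u\<^sup>2/2\<close> gives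
  \<open>n E\<bar>Z\<bar>\<^sup>3 \<le> 2 \<integral>\<bar>x\<bar>\<^sup>3 F(dx) + O(1/n)\<close>. The limit is a bound with constant \<open>2 c\<close>. The right-hand
  side of the theorem is \<open>32 c \<integral>\<bar>x\<bar>\<^sup>3 F(dx) / \<sigma>\<^sup>3\<close>: the moments of \<open>F\<close> are Gamma integrals, and
  the first moments of its two halves are recovered from \<open>\<mu>\<close> and \<open>\<sigma>\<^sup>2\<close> by solving a linear
  system.\<close>

section \<open>Cosine bounds and the third absolute moment\<close>

text \<open>Second-order Taylor remainder of cosine, scaled so that its integral over
  \<open>t\<close> is a multiple of the cube of \<open>\<bar>x\<bar>\<close>. Division by zero gives
  it the value 0 at \<open>t = 0\<close>, so that point needs no exception in the lemmas
  below.\<close>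

definition cos_remainder :: "real \<Rightarrow> real \<Rightarrow> real" where
  "cos_remainder t x = (cos (t * x) - 1 + (t * x)\<^sup>2 / 2) / t ^ 4"

lemma one_minus_cos_le_square: "1 - cos u \<le> u\<^sup>2 / 2" for u :: real
proof -
  have "cos u = 1 - 2 * (sin (u/2))\<^sup>2"
    using cos_double_sin[of "u/2"] by simp
  moreover have "(sin (u/2))\<^sup>2 \<le> (u/2)\<^sup>2"
    using abs_sin_x_le_abs_x[of "u/2"] by (metis abs_le_square_iff)
  ultimately show ?thesis by (simp add: power2_eq_square)
qed

lemma one_minus_cos_le_abs: "1 - cos u \<le> \<bar>u\<bar>" for u :: real
proof -
  have "\<bar>1 - cos u\<bar> \<le> cmod (iexp u - 1)"
    using abs_Re_le_cmod[of "iexp u - 1"] by (simp add: Re_exp)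
  also have "\<dots> \<le> \<bar>u\<bar>"
    using iexp_approx1[of u 0] by simp
  finally show ?thesis by simp
qed

text \<open>This is the real part of the degree-3 Taylor estimate for \<open>iexp u\<close>: the odd
  terms are purely imaginary, and the error is \<open>\<bar>u\<bar> ^ 4 / 4!\<close>.\<close>

lemma cos_upper_quartic: "cos u - 1 + u\<^sup>2 / 2 \<le> u ^ 4 / 24" for u :: real
proof -
  have eq: "iexp u - (\<Sum>k\<le>3. (\<i> * u) ^ k / fact k)
      = iexp u - (1 + \<i> * u - of_real (u\<^sup>2 / 2) - \<i> * of_real (u ^ 3 / 6))"
    by (simp add: eval_nat_numeral field_simps)
  have "Re (iexp u - (\<Sum>k\<le>3. (\<i> * u) ^ k / fact k)) = cos u - 1 + u\<^sup>2 / 2"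
    unfolding eq by (simp add: Re_exp)
  then show ?thesis
    using iexp_approx1[of u 3] complex_Re_le_cmod[of "iexp u - (\<Sum>k\<le>3. (\<i> * u) ^ k / fact k)"]
    by (simp add: eval_nat_numeral)
qed

lemma cos_remainder_nonneg: "cos_remainder t x \<ge> 0"
  using one_minus_cos_le_square[of "t * x"] by (simp add: cos_remainder_def)

lemma measurable_cos_remainder [measurable]:
  "case_prod cos_remainder \<in> borel_measurable (borel \<Otimes>\<^sub>M borel)"
  unfolding cos_remainder_def by measurable

lemma nn_integral_inverse_square_finite:
  "(\<integral>\<^sup>+t. ennreal (B / (1 + t\<^sup>2)) \<partial>lborel) < \<infinity>"
proof -
  have "set_integrable lborel (einterval (-\<infinity>) \<infinity>) (\<lambda>x. inverse (1 + x\<^sup>2))"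
    using integrable_inverse_1_plus_square by simp
  then have "integrable lborel (\<lambda>t::real. inverse (1 + t\<^sup>2))"
    by (simp add: set_integrable_def)
  then have "integrable lborel (\<lambda>t::real. B / (1 + t\<^sup>2))"
    using integrable_mult_right[of B] by (simp add: divide_inverse)
  then have "(\<integral>\<^sup>+t. ennreal (norm (B / (1 + t\<^sup>2))) \<partial>lborel) < \<infinity>"
    by (simp only: integrable_iff_bounded)
  moreover have "(\<integral>\<^sup>+t. ennreal (B / (1 + t\<^sup>2)) \<partial>lborel) \<le> (\<integral>\<^sup>+t. ennreal (norm (B / (1 + t\<^sup>2))) \<partial>lborel)"
    by (intro nn_integral_mono ennreal_leI) (simp only: real_norm_def abs_ge_self)
  ultimately show ?thesis by (rule le_less_trans[rotated])
qed

text \<open>Adding the two bounds gives \<open>(1 + t\<^sup>2) * f t \<le> 2 * B\<close>, hence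
  domination by a multiple of the Cauchy density. The first bound governs small \<open>t\<close>,
  the second large \<open>t\<close>.\<close>

lemma nn_integral_quadratic_decay_finite:
  fixes f :: "real \<Rightarrow> real"
  assumes "\<And>t. f t \<le> B" and "\<And>t. t\<^sup>2 * f t \<le> B"
  shows "(\<integral>\<^sup>+t. ennreal (f t) \<partial>lborel) < \<infinity>"
proof -
  have "f t \<le> 2 * B / (1 + t\<^sup>2)" for t
  proof -
    have "(1 + t\<^sup>2) * f t \<le> 2 * B"
      using assms[of t] by (simp add: algebra_simps)
    moreover have "1 + t\<^sup>2 > 0" by (simp add: add_pos_nonneg)
    ultimately show ?thesis by (simp add: field_simps)
  qed
  then have "(\<integral>\<^sup>+t. ennreal (f t) \<partial>lborel) \<le> (\<integral>\<^sup>+t. ennreal (2 * B / (1 + t\<^sup>2)) \<partial>lborel)"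
    by (intro nn_integral_mono ennreal_leI)
  then show ?thesis
    using nn_integral_inverse_square_finite by (rule le_less_trans)
qed

text \<open>The constant is kept abstract: it cancels from the main term of the moment comparison as
  soon as it is known to lie strictly between 0 and infinity.\<close>

definition cube_const :: ennreal where
  "cube_const = (\<integral>\<^sup>+t. ennreal (cos_remainder t 1) \<partial>lborel)"

text \<open>Replacing \<open>t\<close> by \<open>x * t\<close> turns the integrand into
  \<open>x ^ 4\<close> times the remainder at 1, and the Jacobian takes back one factor
  \<open>\<bar>x\<bar>\<close>.\<close>

lemma nn_integral_cos_remainder:
  "(\<integral>\<^sup>+t. ennreal (cos_remainder t x) \<partial>lborel) = ennreal (\<bar>x\<bar> ^ 3) * cube_const"
proof (cases "x = 0")
  case True
  then show ?thesis by (simp add: cos_remainder_def)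
next
  case False
  \<comment> \<open>The shape \<open>0 + x * t\<close> is the one expected by the affine
    substitution rule for Lebesgue measure.\<close>
  have eq: "cos_remainder t x = x ^ 4 * cos_remainder (0 + x * t) 1" for t
    using False by (cases "t = 0") (simp_all add: cos_remainder_def mult.commute power_mult_distrib)
  have "(\<integral>\<^sup>+t. ennreal (cos_remainder t x) \<partial>lborel)
      = (\<integral>\<^sup>+t. ennreal (x ^ 4) * ennreal (cos_remainder (0 + x * t) 1) \<partial>lborel)"
    by (simp only: eq) (simp add: ennreal_mult cos_remainder_nonneg)
  also have "\<dots> = ennreal (x ^ 4) * (\<integral>\<^sup>+t. ennreal (cos_remainder (0 + x * t) 1) \<partial>lborel)"
    by (intro nn_integral_cmult) measurable
  also have "x ^ 4 = \<bar>x\<bar> ^ 3 * \<bar>x\<bar>"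
    by (simp add: eval_nat_numeral abs_if)
  also have "ennreal (\<bar>x\<bar> ^ 3 * \<bar>x\<bar>) * (\<integral>\<^sup>+t. ennreal (cos_remainder (0 + x * t) 1) \<partial>lborel)
     = ennreal (\<bar>x\<bar> ^ 3) * (ennreal \<bar>x\<bar> * (\<integral>\<^sup>+t. ennreal (cos_remainder (0 + x * t) 1) \<partial>lborel))"
    by (simp add: ennreal_mult mult.assoc)
  also have "ennreal \<bar>x\<bar> * (\<integral>\<^sup>+t. ennreal (cos_remainder (0 + x * t) 1) \<partial>lborel) = cube_const"
    unfolding cube_const_def using False
    by (intro nn_integral_real_affine[symmetric]) measurable
  finally show ?thesis .
qed

lemma cube_const_finite: "cube_const < \<infinity>"
  unfolding cube_const_def
proof (rule nn_integral_quadratic_decay_finite[where B = 1])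
  show "cos_remainder t 1 \<le> 1" for t
  proof (cases "t = 0")
    case False
    have "cos_remainder t 1 \<le> (t ^ 4 / 24) / t ^ 4"
      unfolding cos_remainder_def using cos_upper_quartic[of t] by (intro divide_right_mono) simp_all
    also have "\<dots> \<le> 1" using False by simp
    finally show ?thesis .
  qed (simp add: cos_remainder_def)
  show "t\<^sup>2 * cos_remainder t 1 \<le> 1" for t
  proof (cases "t = 0")
    case False
    have "t\<^sup>2 * cos_remainder t 1 = (cos t - 1 + t\<^sup>2 / 2) / t\<^sup>2"
      using False by (simp add: cos_remainder_def eval_nat_numeral field_simps)
    also have "\<dots> \<le> (t\<^sup>2 / 2) / t\<^sup>2"
      by (intro divide_right_mono) simp_all
    also have "\<dots> \<le> 1" using False by simp
    finally show ?thesis .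
  qed simp
qed

text \<open>A nonnegative integrand with zero integral vanishes almost everywhere, yet on
  \<open>{3..4}\<close> the quadratic term is at least 9/2 while \<open>1 - cos t\<close> is at most
  2.\<close>

lemma cube_const_pos: "cube_const > 0"
proof -
  have "cube_const \<noteq> 0"
  proof
    assume "cube_const = 0"
    then have "AE t in lborel. ennreal (cos_remainder t 1) = 0"
      unfolding cube_const_def by (subst (asm) nn_integral_0_iff_AE) auto
    then have "AE t in lborel. cos_remainder t 1 \<le> 0"
      by eventually_elim (simp add: ennreal_eq_0_iff)
    then have "emeasure lborel {t. \<not> cos_remainder t 1 \<le> 0} = 0"
      by (subst (asm) AE_iff_measurable[OF _ refl]) auto
    moreover have "{3..4::real} \<subseteq> {t. \<not> cos_remainder t 1 \<le> 0}"
    proof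
      fix t :: real assume "t \<in> {3..4}"
      then have "t\<^sup>2 \<ge> 9" "t > 0" using power_mono[of 3 t 2] by simp_all
      then have "cos t - 1 + t\<^sup>2 / 2 > 0" using cos_ge_minus_one[of t] by linarith
      then show "t \<in> {t. \<not> cos_remainder t 1 \<le> 0}"
        using \<open>t > 0\<close> by (simp add: cos_remainder_def divide_simps)
    qed
    moreover have "{t. \<not> cos_remainder t 1 \<le> 0} \<in> sets lborel"
      by measurable
    ultimately have "emeasure lborel {3..4::real} \<le> 0"
      by (metis emeasure_mono)
    then show False by simp
  qed
  then show ?thesis by (simp add: zero_less_iff_neq_zero)
qed

text \<open>Both sides agree at 0, and their difference has derivative
  \<open>- 1 + x + exp (- x) \<ge> 0\<close>. The quadratic term is what later makes the error of
  order \<open>a\<^sup>2\<close>.\<close>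

lemma exp_minus_le_quadratic: "exp (- u) \<le> 1 - u + u\<^sup>2 / 2" if "u \<ge> 0" for u :: real
proof -
  have "1 - 0 + 0\<^sup>2 / 2 - exp (- (0::real)) \<le> 1 - u + u\<^sup>2 / 2 - exp (- u)"
  proof (rule DERIV_nonneg_imp_nondecreasing[OF that])
    fix x :: real
    have "((\<lambda>u. 1 - u + u\<^sup>2 / 2 - exp (- u)) has_real_derivative (- 1 + x + exp (- x))) (at x)"
      by (auto intro!: derivative_eq_intros)
    moreover have "- 1 + x + exp (- x) \<ge> 0"
      using exp_ge_add_one_self[of "- x"] by simp
    ultimately show "\<exists>y. ((\<lambda>u. 1 - u + u\<^sup>2 / 2 - exp (- u)) has_real_derivative y) (at x) \<and> 0 \<le> y"
      by blast
  qed
  then show ?thesis by simp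
qed

section \<open>Small-frequency limits of cosine integrals\<close>

lemma cos_quotient_bounds:
  fixes t x :: real
  assumes "t \<noteq> 0"
  shows "2 * (1 - cos (t * x)) / t\<^sup>2 \<le> x\<^sup>2"
    and "x\<^sup>2 - t\<^sup>2 * x ^ 4 / 12 \<le> 2 * (1 - cos (t * x)) / t\<^sup>2"
proof -
  have t2: "t\<^sup>2 > 0" using assms by simp
  show "2 * (1 - cos (t * x)) / t\<^sup>2 \<le> x\<^sup>2"
    using one_minus_cos_le_square[of "t * x"] t2
    by (simp add: pos_divide_le_eq power_mult_distrib mult.commute)
  have "t ^ 4 = t\<^sup>2 * t\<^sup>2" by (simp add: eval_nat_numeral)
  then show "x\<^sup>2 - t\<^sup>2 * x ^ 4 / 12 \<le> 2 * (1 - cos (t * x)) / t\<^sup>2"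
    using cos_upper_quartic[of "t * x"] t2
    by (simp add: le_divide_eq power_mult_distrib algebra_simps)
qed

lemma two_one_minus_cos_le_abs: "2 * (1 - cos (t * x)) \<le> 2 * (\<bar>t\<bar> * \<bar>x\<bar>)" for t x :: real
  using one_minus_cos_le_abs[of "t * x"] by (simp add: abs_mult)

lemma two_one_minus_cos_le_square: "2 * (1 - cos (t * x)) \<le> t\<^sup>2 * x\<^sup>2" for t x :: real
  using one_minus_cos_le_square[of "t * x"] by (simp add: power_mult_distrib)

lemma cos_quotient_tendsto:
  fixes x :: real and t :: "nat \<Rightarrow> real"
  assumes t: "t \<longlonglongrightarrow> 0" and t_nz: "\<And>k. t k \<noteq> 0"
  shows "(\<lambda>k. 2 * (1 - cos (t k * x)) / (t k)\<^sup>2) \<longlonglongrightarrow> x\<^sup>2"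
proof (rule tendsto_sandwich)
  have "(\<lambda>k. x\<^sup>2 - (t k)\<^sup>2 * x ^ 4 / 12) \<longlonglongrightarrow> x\<^sup>2 - 0\<^sup>2 * x ^ 4 / 12"
    by (intro tendsto_intros t) simp
  then show "(\<lambda>k. x\<^sup>2 - (t k)\<^sup>2 * x ^ 4 / 12) \<longlonglongrightarrow> x\<^sup>2"
    by simp
  show "(\<lambda>k. x\<^sup>2) \<longlonglongrightarrow> x\<^sup>2" by simp
qed (intro always_eventually allI cos_quotient_bounds t_nz)+

text \<open>Dominated convergence with the integrable majorant \<open>x\<^sup>2\<close>. The measure
  may be infinite, so the same limit serves for the Levy measure and for the probability
  law.\<close>

lemma integral_cos_quotient_tendsto:
  fixes M :: "real measure" and t :: "nat \<Rightarrow> real"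
  assumes [measurable_cong]: "sets M = sets borel" and int: "integrable M (\<lambda>x. x\<^sup>2)"
    and t: "t \<longlonglongrightarrow> 0" and t_nz: "\<And>k. t k \<noteq> 0"
  shows "(\<lambda>k. (\<integral>x. 2 * (1 - cos (t k * x)) \<partial>M) / (t k)\<^sup>2) \<longlonglongrightarrow> (\<integral>x. x\<^sup>2 \<partial>M)"
proof -
  have "(\<lambda>k. \<integral>x. 2 * (1 - cos (t k * x)) / (t k)\<^sup>2 \<partial>M) \<longlonglongrightarrow> (\<integral>x. x\<^sup>2 \<partial>M)"
  proof (rule integral_dominated_convergence[where w = "\<lambda>x. x\<^sup>2"])
    show "AE x in M. (\<lambda>k. 2 * (1 - cos (t k * x)) / (t k)\<^sup>2) \<longlonglongrightarrow> x\<^sup>2"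
      using cos_quotient_tendsto[OF t t_nz] by simp
    show "AE x in M. norm (2 * (1 - cos (t k * x)) / (t k)\<^sup>2) \<le> x\<^sup>2" for k
      using cos_quotient_bounds(1)[OF t_nz[of k]] by (simp add: abs_mult)
  qed (use int in measurable)
  then show ?thesis by simp
qed

text \<open>The remainder is split into a square and \<open>1 - cos\<close>, never into
  \<open>cos\<close> and a constant: over an infinite measure the constant has no finite
  integral.\<close>

lemma integral_cos_remainder:
  fixes M :: "real measure"
  assumes "t \<noteq> 0" and square: "integrable M (\<lambda>x. x\<^sup>2)"
    and cos: "integrable M (\<lambda>x. 2 * (1 - cos (t * x)))"
  shows "integrable M (\<lambda>x. cos_remainder t x)"
    and "2 * (\<integral>x. cos_remainder t x \<partial>M) = (t\<^sup>2 * (\<integral>x. x\<^sup>2 \<partial>M) - (\<integral>x. 2 * (1 - cos (t * x)) \<partial>M)) / t ^ 4"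
proof -
  have eq: "cos_remainder t x = t\<^sup>2 * x\<^sup>2 / (2 * t ^ 4) - 2 * (1 - cos (t * x)) / (2 * t ^ 4)" for x
    using assms(1) by (simp add: cos_remainder_def field_simps power_mult_distrib)
  show "integrable M (\<lambda>x. cos_remainder t x)"
    unfolding eq using square cos
    by (intro Bochner_Integration.integrable_diff integrable_divide) simp_all
  have "(\<integral>x. cos_remainder t x \<partial>M)
      = (\<integral>x. t\<^sup>2 * x\<^sup>2 / (2 * t ^ 4) \<partial>M) - (\<integral>x. 2 * (1 - cos (t * x)) / (2 * t ^ 4) \<partial>M)"
    unfolding eq using square cos
    by (intro Bochner_Integration.integral_diff integrable_divide) simp_all
  also have "\<dots> = t\<^sup>2 * (\<integral>x. x\<^sup>2 \<partial>M) / (2 * t ^ 4) - (\<integral>x. 2 * (1 - cos (t * x)) \<partial>M) / (2 * t ^ 4)"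
    unfolding integral_divide_zero by simp
  also have "\<dots> = (t\<^sup>2 * (\<integral>x. x\<^sup>2 \<partial>M) - (\<integral>x. 2 * (1 - cos (t * x)) \<partial>M)) / (2 * t ^ 4)"
    by (simp only: diff_divide_distrib)
  finally have "2 * (\<integral>x. cos_remainder t x \<partial>M) = 2 * ((t\<^sup>2 * (\<integral>x. x\<^sup>2 \<partial>M) - (\<integral>x. 2 * (1 - cos (t * x)) \<partial>M)) / (2 * t ^ 4))"
    by (rule arg_cong)
  also have "\<dots> = (t\<^sup>2 * (\<integral>x. x\<^sup>2 \<partial>M) - (\<integral>x. 2 * (1 - cos (t * x)) \<partial>M)) / t ^ 4"
    by (simp only: times_divide_eq_right mult_divide_mult_cancel_left_if) simp
  finally show "2 * (\<integral>x. cos_remainder t x \<partial>M) = (t\<^sup>2 * (\<integral>x. x\<^sup>2 \<partial>M) - (\<integral>x. 2 * (1 - cos (t * x)) \<partial>M)) / t ^ 4" .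
qed

section \<open>Symbol of a Levy measure and moments of the laws it generates\<close>

locale third_moment_measure = sigma_finite_measure F for F :: "real measure" +
  assumes sets_F [measurable_cong]: "sets F = sets borel"
    and integrable_abs: "integrable F (\<lambda>x. \<bar>x\<bar>)"
    and integrable_square: "integrable F (\<lambda>x. x\<^sup>2)"
    and integrable_cube: "integrable F (\<lambda>x. \<bar>x\<bar> ^ 3)"

context third_moment_measure
begin

text \<open>Minus twice the real part of the characteristic exponent, which is the real exponent
  left after symmetrizing.\<close>

definition symbol :: "real \<Rightarrow> real" where
  "symbol t = (\<integral>x. 2 * (1 - cos (t * x)) \<partial>F)"

lemma integrable_cos: "integrable F (\<lambda>x. 2 * (1 - cos (t * x)))"
proof (rule Bochner_Integration.integrable_bound)
  show "integrable F (\<lambda>x. 2 * (\<bar>t\<bar> * \<bar>x\<bar>))"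
    using integrable_abs by simp
  show "AE x in F. norm (2 * (1 - cos (t * x))) \<le> norm (2 * (\<bar>t\<bar> * \<bar>x\<bar>))"
    using two_one_minus_cos_le_abs by simp
qed measurable

lemma symbol_nonneg: "symbol t \<ge> 0"
  unfolding symbol_def by (intro integral_nonneg_AE) simp

lemma symbol_le_abs: "symbol t \<le> 2 * \<bar>t\<bar> * (\<integral>x. \<bar>x\<bar> \<partial>F)"
proof -
  have "symbol t \<le> (\<integral>x. 2 * (\<bar>t\<bar> * \<bar>x\<bar>) \<partial>F)"
    unfolding symbol_def using two_one_minus_cos_le_abs integrable_abs
    by (intro integral_mono integrable_cos) simp_all
  then show ?thesis by simp
qed

lemma symbol_le_square: "symbol t \<le> t\<^sup>2 * (\<integral>x. x\<^sup>2 \<partial>F)"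
proof -
  have "symbol t \<le> (\<integral>x. t\<^sup>2 * x\<^sup>2 \<partial>F)"
    unfolding symbol_def using two_one_minus_cos_le_square integrable_square
    by (intro integral_mono integrable_cos) simp_all
  then show ?thesis by simp
qed

lemma measurable_symbol [measurable]: "symbol \<in> borel_measurable borel"
  unfolding symbol_def by measurable

definition symbol_error :: ennreal where
  "symbol_error = (\<integral>\<^sup>+t. ennreal ((symbol t)\<^sup>2 / t ^ 4) \<partial>lborel)"

text \<open>The symbol is \<open>O(t\<^sup>2)\<close>, by the second moment, and
  \<open>O(\<bar>t\<bar>)\<close>, by the first. The former keeps the integrand bounded at the
  origin, the latter makes it decay like \<open>1 / t\<^sup>2\<close>.\<close>

lemma symbol_error_finite: "symbol_error < \<infinity>"
  unfolding symbol_error_def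
proof (rule nn_integral_quadratic_decay_finite)
  fix t :: real
  let ?v = "\<integral>x. x\<^sup>2 \<partial>F" and ?m = "2 * (\<integral>x. \<bar>x\<bar> \<partial>F)"
  have "(symbol t)\<^sup>2 \<le> (t\<^sup>2 * ?v)\<^sup>2"
    using symbol_le_square symbol_nonneg by (intro power_mono)
  also have "\<dots> = t ^ 4 * ?v\<^sup>2" by (simp add: eval_nat_numeral mult_ac)
  finally have "(symbol t)\<^sup>2 / t ^ 4 \<le> t ^ 4 * ?v\<^sup>2 / t ^ 4"
    by (rule divide_right_mono) simp
  also have "\<dots> \<le> ?v\<^sup>2" by simp
  finally show "(symbol t)\<^sup>2 / t ^ 4 \<le> ?v\<^sup>2 + ?m\<^sup>2"
    by (rule order_trans) simp
  have "(symbol t)\<^sup>2 \<le> (\<bar>t\<bar> * ?m)\<^sup>2"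
    using symbol_le_abs[of t] symbol_nonneg by (intro power_mono) (simp_all add: mult_ac)
  also have "\<dots> = t\<^sup>2 * ?m\<^sup>2" by (simp add: power_mult_distrib)
  finally have "(symbol t)\<^sup>2 / t\<^sup>2 \<le> t\<^sup>2 * ?m\<^sup>2 / t\<^sup>2"
    by (rule divide_right_mono) simp
  also have "\<dots> \<le> ?m\<^sup>2" by simp
  also have "(symbol t)\<^sup>2 / t\<^sup>2 = t\<^sup>2 * ((symbol t)\<^sup>2 / t ^ 4)"
    by (simp add: eval_nat_numeral)
  finally show "t\<^sup>2 * ((symbol t)\<^sup>2 / t ^ 4) \<le> ?v\<^sup>2 + ?m\<^sup>2"
    by (rule order_trans) simp
qed

end

text \<open>\<open>D\<close> stands for the symmetrization of an n-th convolution root, with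
  \<open>a = 1 / n\<close>. The case \<open>a = 1\<close> covers the symmetrization of the law
  itself.\<close>

locale symmetrized_root = third_moment_measure F + D: real_distribution D
  for F D :: "real measure" +
  fixes a :: real
  assumes a_nonneg: "a \<ge> 0"
    and char_eq: "char D t = of_real (exp (- (a * symbol t)))"
begin

lemma integrable_cos_D: "integrable D (\<lambda>z. 2 * (1 - cos (t * z)))"
proof -
  have "integrable D (\<lambda>z. cos (t * z))"
    by (intro D.integrable_const_bound[of _ 1] AE_I2) simp_all
  then show ?thesis by simp
qed

lemma integral_cos_D: "(\<integral>z. 2 * (1 - cos (t * z)) \<partial>D) = 2 * (1 - exp (- (a * symbol t)))"
proof -
  have int: "integrable D (\<lambda>z. iexp (t * z))"
    by (intro D.integrable_iexp) auto
  have "exp (- (a * symbol t)) = Re (char D t)"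
    by (simp add: char_eq)
  also have "\<dots> = (\<integral>z. cos (t * z) \<partial>D)"
    unfolding char_def using int by (subst integral_Re[symmetric]) (simp_all add: Re_exp)
  finally have "(\<integral>z. cos (t * z) \<partial>D) = exp (- (a * symbol t))" ..
  moreover have "integrable D (\<lambda>z. cos (t * z))"
    using integrable_Re[OF int] by (simp add: Re_exp)
  ultimately show ?thesis
    using D.prob_space by simp
qed

text \<open>Integrability comes first, from Fatou's lemma: the quotients tend to
  \<open>z\<^sup>2\<close> and their integrals are bounded because
  \<open>1 - exp (- u) \<le> u\<close>. Only then is dominated convergence available, and the limit
  is identified by squeezing.\<close>

lemma second_moment:
  shows "integrable D (\<lambda>z. z\<^sup>2)" and "(\<integral>z. z\<^sup>2 \<partial>D) = 2 * a * (\<integral>x. x\<^sup>2 \<partial>F)"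
proof -
  define v where "v = (\<integral>x. x\<^sup>2 \<partial>F)"
  define t where "t k = inverse (real (Suc k))" for k
  have t: "t \<longlonglongrightarrow> 0" and t_nz: "t k \<noteq> 0" for k
    unfolding t_def using LIMSEQ_inverse_real_of_nat by simp_all
  have v: "v \<ge> 0" unfolding v_def by (intro integral_nonneg_AE) simp
  have upper: "2 * (1 - exp (- (a * symbol s))) \<le> 2 * a * symbol s" for s
    using exp_ge_add_one_self[of "- (a * symbol s)"] by simp
  have "(\<integral>\<^sup>+z. ennreal (z\<^sup>2) \<partial>D) = (\<integral>\<^sup>+z. liminf (\<lambda>k. ennreal (2 * (1 - cos (t k * z)) / (t k)\<^sup>2)) \<partial>D)"
    by (intro nn_integral_cong lim_imp_Liminf[symmetric] tendsto_ennrealI cos_quotient_tendsto t t_nz)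
       simp
  also have "\<dots> \<le> liminf (\<lambda>k. \<integral>\<^sup>+z. ennreal (2 * (1 - cos (t k * z)) / (t k)\<^sup>2) \<partial>D)"
    by (intro nn_integral_liminf) measurable
  also have "\<dots> \<le> liminf (\<lambda>k::nat. ennreal (2 * a * v))"
  proof (intro Liminf_mono always_eventually allI)
    fix k
    have "(\<integral>\<^sup>+z. ennreal (2 * (1 - cos (t k * z)) / (t k)\<^sup>2) \<partial>D)
        = ennreal ((\<integral>z. 2 * (1 - cos (t k * z)) \<partial>D) / (t k)\<^sup>2)"
      using integrable_cos_D[of "t k"]
      by (subst nn_integral_eq_integral) (auto intro: integrable_divide)
    also have "\<dots> \<le> ennreal (2 * a * v)"
    proof (rule ennreal_leI)
      have "(\<integral>z. 2 * (1 - cos (t k * z)) \<partial>D) \<le> 2 * a * symbol (t k)"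
        unfolding integral_cos_D by (rule upper)
      also have "\<dots> \<le> 2 * a * ((t k)\<^sup>2 * v)"
        unfolding v_def using a_nonneg symbol_le_square by (intro mult_left_mono) simp_all
      finally show "(\<integral>z. 2 * (1 - cos (t k * z)) \<partial>D) / (t k)\<^sup>2 \<le> 2 * a * v"
        using t_nz[of k] by (simp add: pos_divide_le_eq mult_ac)
    qed
    finally show "(\<integral>\<^sup>+z. ennreal (2 * (1 - cos (t k * z)) / (t k)\<^sup>2) \<partial>D) \<le> ennreal (2 * a * v)" .
  qed
  also have "\<dots> = ennreal (2 * a * v)" by (simp add: Liminf_const)
  finally show int: "integrable D (\<lambda>z. z\<^sup>2)"
    by (intro integrableI_bounded) (auto intro: le_less_trans)
  have "(\<lambda>k. 2 * (1 - exp (- (a * symbol (t k)))) / (t k)\<^sup>2) \<longlonglongrightarrow> (\<integral>z. z\<^sup>2 \<partial>D)"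
    using integral_cos_quotient_tendsto[OF _ int t t_nz] by (simp only: integral_cos_D) simp
  moreover have "(\<lambda>k. 2 * (1 - exp (- (a * symbol (t k)))) / (t k)\<^sup>2) \<longlonglongrightarrow> 2 * a * v"
  proof (rule tendsto_sandwich)
    \<comment> \<open>The lower squeeze is \<open>2 * u - u\<^sup>2\<close> over
      \<open>(t k)\<^sup>2\<close>. Its correction is written with a spare factor
      \<open>(t k)\<^sup>2\<close>, which sends it to 0.\<close>
    show "\<forall>\<^sub>F k in sequentially. 2 * a * (symbol (t k) / (t k)\<^sup>2) - a\<^sup>2 * ((t k)\<^sup>2 * (symbol (t k) / (t k)\<^sup>2)\<^sup>2)
        \<le> 2 * (1 - exp (- (a * symbol (t k)))) / (t k)\<^sup>2"
    proof (intro always_eventually allI)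
      fix k
      let ?u = "a * symbol (t k)"
      have "2 * a * (symbol (t k) / (t k)\<^sup>2) - a\<^sup>2 * ((t k)\<^sup>2 * (symbol (t k) / (t k)\<^sup>2)\<^sup>2)
          = (2 * ?u - ?u\<^sup>2) / (t k)\<^sup>2"
        using t_nz[of k] by (simp add: field_simps power2_eq_square)
      also have "\<dots> \<le> 2 * (1 - exp (- ?u)) / (t k)\<^sup>2"
        using exp_minus_le_quadratic[of ?u] a_nonneg symbol_nonneg[of "t k"]
        by (intro divide_right_mono) simp_all
      finally show "2 * a * (symbol (t k) / (t k)\<^sup>2) - a\<^sup>2 * ((t k)\<^sup>2 * (symbol (t k) / (t k)\<^sup>2)\<^sup>2)
        \<le> 2 * (1 - exp (- (a * symbol (t k)))) / (t k)\<^sup>2" .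
    qed
    show "\<forall>\<^sub>F k in sequentially. 2 * (1 - exp (- (a * symbol (t k)))) / (t k)\<^sup>2
        \<le> 2 * a * (symbol (t k) / (t k)\<^sup>2)"
      using upper by (simp add: divide_right_mono)
    have lim: "(\<lambda>k. symbol (t k) / (t k)\<^sup>2) \<longlonglongrightarrow> v"
      unfolding v_def symbol_def
      by (intro integral_cos_quotient_tendsto sets_F integrable_square t t_nz)
    have "(\<lambda>k. 2 * a * (symbol (t k) / (t k)\<^sup>2) - a\<^sup>2 * ((t k)\<^sup>2 * (symbol (t k) / (t k)\<^sup>2)\<^sup>2))
        \<longlonglongrightarrow> 2 * a * v - a\<^sup>2 * (0\<^sup>2 * v\<^sup>2)"
      by (intro tendsto_intros lim t)
    then show "(\<lambda>k. 2 * a * (symbol (t k) / (t k)\<^sup>2) - a\<^sup>2 * ((t k)\<^sup>2 * (symbol (t k) / (t k)\<^sup>2)\<^sup>2))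
        \<longlonglongrightarrow> 2 * a * v" by simp
    show "(\<lambda>k. 2 * a * (symbol (t k) / (t k)\<^sup>2)) \<longlonglongrightarrow> 2 * a * v"
      by (intro tendsto_intros lim)
  qed
  ultimately show "(\<integral>z. z\<^sup>2 \<partial>D) = 2 * a * (\<integral>x. x\<^sup>2 \<partial>F)"
    unfolding v_def by (rule LIMSEQ_unique)
qed

text \<open>The second moment of \<open>D\<close> is exactly \<open>2 * a\<close> times that of
  \<open>F\<close>, so the quadratic terms match and the only loss is
  \<open>exp (- u) \<le> 1 - u + u\<^sup>2 / 2\<close>. At \<open>t = 0\<close> everything is
  0.\<close>

lemma integral_cos_remainder_le:
  "(\<integral>\<^sup>+z. ennreal (cos_remainder t z) \<partial>D)
    \<le> ennreal (2 * a) * (\<integral>\<^sup>+x. ennreal (cos_remainder t x) \<partial>F)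
      + ennreal (a\<^sup>2 / 2) * ennreal ((symbol t)\<^sup>2 / t ^ 4)"
proof (cases "t = 0")
  case False
  note F = integral_cos_remainder[OF False integrable_square integrable_cos]
  note D = integral_cos_remainder[OF False second_moment(1) integrable_cos_D]
  let ?v = "\<integral>x. x\<^sup>2 \<partial>F" and ?u = "a * symbol t"
  have "2 * (\<integral>z. cos_remainder t z \<partial>D) = (t\<^sup>2 * (2 * a * ?v) - 2 * (1 - exp (- ?u))) / t ^ 4"
    by (simp only: D second_moment integral_cos_D)
  also have "\<dots> \<le> (2 * a * (t\<^sup>2 * ?v - symbol t) + a\<^sup>2 * (symbol t)\<^sup>2) / t ^ 4"
    using exp_minus_le_quadratic[of ?u] a_nonneg symbol_nonneg[of t]
    by (intro divide_right_mono) (simp_all add: algebra_simps power_mult_distrib)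
  also have "\<dots> = 2 * (2 * a * (\<integral>x. cos_remainder t x \<partial>F) + a\<^sup>2 / 2 * ((symbol t)\<^sup>2 / t ^ 4))"
    using F(2)[folded symbol_def, symmetric]
    by (simp only: add_divide_distrib times_divide_eq_right[symmetric] distrib_left)
  finally have "(\<integral>z. cos_remainder t z \<partial>D)
      \<le> 2 * a * (\<integral>x. cos_remainder t x \<partial>F) + a\<^sup>2 / 2 * ((symbol t)\<^sup>2 / t ^ 4)"
    by simp
  then have "ennreal (\<integral>z. cos_remainder t z \<partial>D)
      \<le> ennreal (2 * a * (\<integral>x. cos_remainder t x \<partial>F) + a\<^sup>2 / 2 * ((symbol t)\<^sup>2 / t ^ 4))"
    by (rule ennreal_leI)
  also have "\<dots> = ennreal (2 * a) * ennreal (\<integral>x. cos_remainder t x \<partial>F)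
      + ennreal (a\<^sup>2 / 2) * ennreal ((symbol t)\<^sup>2 / t ^ 4)"
    using a_nonneg by (subst ennreal_plus)
      (auto simp: cos_remainder_nonneg integral_nonneg_AE ennreal_mult[symmetric])
  finally show ?thesis
    using F(1) D(1) by (simp add: nn_integral_eq_integral cos_remainder_nonneg)
qed (simp add: cos_remainder_def)

text \<open>Integrating the pointwise comparison over \<open>t\<close> and exchanging integrals by
  Tonelli turns each cosine remainder into a third absolute moment times
  \<open>cube_const\<close>.\<close>

lemma third_moment:
  shows "integrable D (\<lambda>z. \<bar>z\<bar> ^ 3)"
    and "(\<integral>z. \<bar>z\<bar> ^ 3 \<partial>D) \<le> 2 * a * (\<integral>x. \<bar>x\<bar> ^ 3 \<partial>F)
      + a\<^sup>2 * (enn2real symbol_error / (2 * enn2real cube_const))"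
proof -
  interpret FL: pair_sigma_finite lborel F ..
  interpret DL: pair_sigma_finite lborel D ..
  define k e m3 where "k = enn2real cube_const" and "e = enn2real symbol_error"
    and "m3 = (\<integral>x. \<bar>x\<bar> ^ 3 \<partial>F)"
  have k: "cube_const = ennreal k" "k > 0"
    using cube_const_finite cube_const_pos by (auto simp: k_def enn2real_positive_iff)
  have e: "symbol_error = ennreal e" "e \<ge> 0"
    using symbol_error_finite by (auto simp: e_def)
  have m3: "(\<integral>\<^sup>+x. ennreal (\<bar>x\<bar> ^ 3) \<partial>F) = ennreal m3" "m3 \<ge> 0"
    unfolding m3_def using integrable_cube by (auto simp: nn_integral_eq_integral integral_nonneg_AE)
  let ?I = "\<integral>\<^sup>+z. ennreal (\<bar>z\<bar> ^ 3) \<partial>D"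
  have "?I * ennreal k = (\<integral>\<^sup>+z. \<integral>\<^sup>+t. ennreal (cos_remainder t z) \<partial>lborel \<partial>D)"
    by (simp add: nn_integral_cos_remainder k nn_integral_multc)
  also have "\<dots> = (\<integral>\<^sup>+t. \<integral>\<^sup>+z. ennreal (cos_remainder t z) \<partial>D \<partial>lborel)"
    by (rule DL.Fubini') measurable
  also have "\<dots> \<le> (\<integral>\<^sup>+t. ennreal (2 * a) * (\<integral>\<^sup>+x. ennreal (cos_remainder t x) \<partial>F)
      + ennreal (a\<^sup>2 / 2) * ennreal ((symbol t)\<^sup>2 / t ^ 4) \<partial>lborel)"
    by (intro nn_integral_mono integral_cos_remainder_le)
  also have "\<dots> = ennreal (2 * a) * (\<integral>\<^sup>+t. \<integral>\<^sup>+x. ennreal (cos_remainder t x) \<partial>F \<partial>lborel)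
      + ennreal (a\<^sup>2 / 2) * symbol_error"
    unfolding symbol_error_def by (simp add: nn_integral_add nn_integral_cmult)
  also have "(\<integral>\<^sup>+t. \<integral>\<^sup>+x. ennreal (cos_remainder t x) \<partial>F \<partial>lborel)
      = (\<integral>\<^sup>+x. \<integral>\<^sup>+t. ennreal (cos_remainder t x) \<partial>lborel \<partial>F)"
    by (rule FL.Fubini'[symmetric]) measurable
  also have "\<dots> = ennreal m3 * ennreal k"
    by (simp add: nn_integral_cos_remainder k nn_integral_multc m3)
  also have "ennreal (2 * a) * (ennreal m3 * ennreal k) + ennreal (a\<^sup>2 / 2) * symbol_error
      = ennreal (2 * a * m3 * k + a\<^sup>2 / 2 * e)"
    unfolding e(1) using a_nonneg k(2) m3(2) e(2)
    by (simp add: ennreal_mult[symmetric] ennreal_plus[symmetric] mult.assoc del: ennreal_plus)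
  finally have bound: "?I * ennreal k \<le> ennreal (2 * a * m3 * k + a\<^sup>2 / 2 * e)" .
  \<comment> \<open>Integrability is a conclusion here: the estimate was made in
    \<open>ennreal\<close>, its right side is finite and \<open>k > 0\<close>.\<close>
  have "?I \<noteq> \<infinity>"
  proof
    assume "?I = \<infinity>"
    then show False using bound k(2) by (simp add: ennreal_top_mult top_unique)
  qed
  then show int: "integrable D (\<lambda>z. \<bar>z\<bar> ^ 3)"
    by (intro integrableI_bounded) (auto simp: less_top)
  then have "?I = ennreal (\<integral>z. \<bar>z\<bar> ^ 3 \<partial>D)"
    by (intro nn_integral_eq_integral) auto
  then have "(\<integral>z. \<bar>z\<bar> ^ 3 \<partial>D) * k \<le> 2 * a * m3 * k + a\<^sup>2 / 2 * e"
    using bound k(2) a_nonneg m3(2) e(2)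
    by (simp add: ennreal_mult[symmetric] integral_nonneg_AE del: ennreal_plus)
  then have "(\<integral>z. \<bar>z\<bar> ^ 3 \<partial>D) \<le> (2 * a * m3 * k + a\<^sup>2 / 2 * e) / k"
    using k(2) by (simp add: pos_le_divide_eq)
  also have "\<dots> = 2 * a * m3 + a\<^sup>2 * (e / (2 * k))"
    using k(2) by (simp add: add_divide_distrib)
  finally show "(\<integral>z. \<bar>z\<bar> ^ 3 \<partial>D) \<le> 2 * a * (\<integral>x. \<bar>x\<bar> ^ 3 \<partial>F)
      + a\<^sup>2 * (enn2real symbol_error / (2 * enn2real cube_const))"
    by (simp only: k_def e_def m3_def)
qed

end

section \<open>Symmetrization\<close>

text \<open>The tangent at \<open>b\<close> lies below the convex function. For
  \<open>a, b \<ge> 0\<close> the gap is \<open>(a - b)\<^sup>2 * (a + 2 * b)\<close>; negative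
  \<open>b\<close> is handled by reflection.\<close>

lemma abs_cube_tangent: "\<bar>b\<bar> ^ 3 + 3 * b * \<bar>b\<bar> * (a - b) \<le> \<bar>a\<bar> ^ 3" for a b :: real
proof -
  have nonneg: "\<bar>b\<bar> ^ 3 + 3 * b * \<bar>b\<bar> * (a - b) \<le> \<bar>a\<bar> ^ 3" if b: "b \<ge> 0" for a b :: real
  proof (cases "a \<ge> 0")
    case True
    have "\<bar>a\<bar> ^ 3 - (\<bar>b\<bar> ^ 3 + 3 * b * \<bar>b\<bar> * (a - b)) = (a - b)\<^sup>2 * (a + 2 * b)"
      using b True by (simp add: eval_nat_numeral algebra_simps)
    also have "\<dots> \<ge> 0" using b True by simp
    finally show ?thesis by simp
  next
    case False
    have "\<bar>a\<bar> ^ 3 - (\<bar>b\<bar> ^ 3 + 3 * b * \<bar>b\<bar> * (a - b)) = (- a) ^ 3 + 2 * b ^ 3 + 3 * b\<^sup>2 * (- a)"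
      using b False by (simp add: eval_nat_numeral algebra_simps)
    also have "\<dots> \<ge> 0" using b False by (intro add_nonneg_nonneg mult_nonneg_nonneg zero_le_power) auto
    finally show ?thesis by simp
  qed
  show ?thesis
    using nonneg[of b a] nonneg[of "- b" "- a"] by (cases "b \<ge> 0") (auto simp: algebra_simps)
qed

lemma abs_cube_add_le: "\<bar>a + b\<bar> ^ 3 \<le> 4 * (\<bar>a\<bar> ^ 3 + \<bar>b\<bar> ^ 3)" for a b :: real
proof -
  have "\<bar>a + b\<bar> ^ 3 \<le> (\<bar>a\<bar> + \<bar>b\<bar>) ^ 3"
    by (intro power_mono abs_triangle_ineq) simp
  moreover have "4 * (\<bar>a\<bar> ^ 3 + \<bar>b\<bar> ^ 3) - (\<bar>a\<bar> + \<bar>b\<bar>) ^ 3 = 3 * (\<bar>a\<bar> + \<bar>b\<bar>) * (\<bar>a\<bar> - \<bar>b\<bar>)\<^sup>2"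
    by (simp add: eval_nat_numeral algebra_simps)
  moreover have "3 * (\<bar>a\<bar> + \<bar>b\<bar>) * (\<bar>a\<bar> - \<bar>b\<bar>)\<^sup>2 \<ge> 0"
    by (intro mult_nonneg_nonneg) simp_all
  ultimately show ?thesis by linarith
qed

lemma abs_power_le_one_plus_cube: "\<bar>x\<bar> ^ k \<le> 1 + \<bar>x\<bar> ^ 3" if "k \<le> 3" for x :: real
proof (cases "\<bar>x\<bar> \<le> 1")
  case True
  then have "\<bar>x\<bar> ^ k \<le> 1" by (simp add: power_le_one)
  then show ?thesis by (simp add: add_increasing2)
next
  case False
  then have "\<bar>x\<bar> ^ k \<le> \<bar>x\<bar> ^ 3" using that by (intro power_increasing) simp_all
  then show ?thesis by simp
qed

lemma integrable_lower_moments: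
  fixes L :: "real measure"
  assumes "finite_measure L" and [measurable_cong]: "sets L = sets borel"
    and int: "integrable L (\<lambda>x. \<bar>x\<bar> ^ 3)"
  shows "integrable L (\<lambda>x. x)" and "integrable L (\<lambda>x. x\<^sup>2)"
proof -
  interpret finite_measure L by fact
  have bound: "integrable L (\<lambda>x. 1 + \<bar>x\<bar> ^ 3)"
    using int by simp
  show "integrable L (\<lambda>x. x)"
    by (rule Bochner_Integration.integrable_bound[OF bound]) (use abs_power_le_one_plus_cube[of 1] in \<open>auto simp: add_nonneg_nonneg\<close>)
  show "integrable L (\<lambda>x. x\<^sup>2)"
    by (rule Bochner_Integration.integrable_bound[OF bound]) (use abs_power_le_one_plus_cube[of 2] in \<open>auto simp: add_nonneg_nonneg\<close>)
qed

definition symmetrization :: "real measure \<Rightarrow> real measure" where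
  "symmetrization L = distr (L \<Otimes>\<^sub>M L) borel (\<lambda>(x, y). x - y)"

context real_distribution
begin

sublocale pair: pair_prob_space M M ..

lemma real_distribution_symmetrization: "real_distribution (symmetrization M)"
  unfolding symmetrization_def by (intro pair.real_distribution_distr) measurable

lemma char_symmetrization: "char (symmetrization M) t = of_real ((cmod (char M t))\<^sup>2)"
proof -
  have int: "integrable (M \<Otimes>\<^sub>M M) (\<lambda>(x, y). iexp (t * (x - y)))"
    by (intro pair.integrable_const_bound[of _ 1] AE_I2) auto
  have "char (symmetrization M) t = (\<integral>p. (case p of (x, y) \<Rightarrow> iexp (t * (x - y))) \<partial>(M \<Otimes>\<^sub>M M))"
    unfolding char_def symmetrization_def by (subst integral_distr) (auto simp: split_beta')
  also have "\<dots> = (\<integral>x. \<integral>y. iexp (t * (x - y)) \<partial>M \<partial>M)"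
    using pair.integral_fst[OF int] ..
  also have "\<dots> = (\<integral>x. \<integral>y. iexp (t * x) * cnj (iexp (t * y)) \<partial>M \<partial>M)"
    by (simp add: exp_cnj exp_add[symmetric] algebra_simps)
  also have "\<dots> = char M t * cnj (char M t)"
    by (simp add: char_def)
  also have "\<dots> = of_real ((cmod (char M t))\<^sup>2)"
    by (simp add: complex_mult_cnj cmod_power2)
  finally show ?thesis .
qed

text \<open>By Fubini \<open>\<bar>x - y\<bar> ^ 3\<close> is integrable in \<open>y\<close> for
  almost every \<open>x\<close>, hence for some \<open>x\<close> because the total mass is 1. Fixing
  that \<open>x\<close>, \<open>\<bar>y\<bar> ^ 3\<close> is dominated up to a constant.\<close>

lemma integrable_cube_symmetrizationD:
  assumes "integrable (symmetrization M) (\<lambda>z. \<bar>z\<bar> ^ 3)"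
  shows "integrable (M \<Otimes>\<^sub>M M) (\<lambda>(x, y). \<bar>x - y\<bar> ^ 3)" and "integrable M (\<lambda>x. \<bar>x\<bar> ^ 3)"
proof -
  show int: "integrable (M \<Otimes>\<^sub>M M) (\<lambda>(x, y). \<bar>x - y\<bar> ^ 3)"
    using assms unfolding symmetrization_def
    by (subst (asm) integrable_distr_eq) (auto simp: split_beta')
  have "AE x in M. integrable M (\<lambda>y. \<bar>x - y\<bar> ^ 3)"
    using pair.AE_integrable_fst[OF int] .
  then obtain x where x: "integrable M (\<lambda>y. \<bar>x - y\<bar> ^ 3)"
    using eventually_happens'[OF ae_filter_bot] by blast
  have "integrable M (\<lambda>y. 4 * (\<bar>x\<bar> ^ 3 + \<bar>x - y\<bar> ^ 3))"
    using x by simp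
  then show "integrable M (\<lambda>x. \<bar>x\<bar> ^ 3)"
  proof (rule Bochner_Integration.integrable_bound)
    show "AE y in M. norm (\<bar>y\<bar> ^ 3) \<le> norm (4 * (\<bar>x\<bar> ^ 3 + \<bar>x - y\<bar> ^ 3))"
      using abs_cube_add_le[of x "y - x" for y] by (simp add: abs_minus_commute)
  qed measurable
qed

lemma symmetrization_moments:
  assumes int: "integrable (symmetrization M) (\<lambda>z. \<bar>z\<bar> ^ 3)"
  shows "(\<integral>z. z\<^sup>2 \<partial>symmetrization M) = 2 * variance (\<lambda>x. x)"
    and "integrable M (\<lambda>x. \<bar>x - expectation (\<lambda>x. x)\<bar> ^ 3)"
    and "expectation (\<lambda>x. \<bar>x - expectation (\<lambda>x. x)\<bar> ^ 3) \<le> (\<integral>z. \<bar>z\<bar> ^ 3 \<partial>symmetrization M)"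
proof -
  define m where "m = expectation (\<lambda>x. x)"
  note cube = integrable_cube_symmetrizationD[OF int]
  note low = integrable_lower_moments[OF finite_measure_axioms events_eq_borel cube(2)]
  have [simp]: "prob UNIV = 1"
    using prob_space by simp
  have sq: "(\<integral>y. (x - y)\<^sup>2 \<partial>M) = x\<^sup>2 - 2 * x * m + expectation (\<lambda>y. y\<^sup>2)" for x
    using low by (simp add: power2_diff m_def prob_space)
  have int_sq: "integrable (M \<Otimes>\<^sub>M M) (\<lambda>(x, y). (x - y)\<^sup>2)"
  proof (rule Bochner_Integration.integrable_bound)
    show "integrable (M \<Otimes>\<^sub>M M) (\<lambda>p. 1 + (case p of (x, y) \<Rightarrow> \<bar>x - y\<bar> ^ 3))"
      using cube(1) by simp
    show "AE p in M \<Otimes>\<^sub>M M. norm (case p of (x, y) \<Rightarrow> (x - y)\<^sup>2)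
        \<le> norm (1 + (case p of (x, y) \<Rightarrow> \<bar>x - y\<bar> ^ 3))"
      by (intro AE_I2) (use abs_power_le_one_plus_cube[of 2] in \<open>auto simp: add_nonneg_nonneg\<close>)
  qed measurable
  have "(\<integral>z. z\<^sup>2 \<partial>symmetrization M) = (\<integral>p. (case p of (x, y) \<Rightarrow> (x - y)\<^sup>2) \<partial>(M \<Otimes>\<^sub>M M))"
    unfolding symmetrization_def by (subst integral_distr) (auto simp: split_beta')
  also have "\<dots> = (\<integral>x. \<integral>y. (x - y)\<^sup>2 \<partial>M \<partial>M)"
    using pair.integral_fst[OF int_sq] ..
  also have "\<dots> = 2 * (expectation (\<lambda>x. x\<^sup>2) - m\<^sup>2)"
    unfolding sq using low by (simp add: m_def) (simp add: power2_eq_square)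
  also have "\<dots> = 2 * variance (\<lambda>x. x)"
    using low by (simp add: variance_eq m_def)
  finally show "(\<integral>z. z\<^sup>2 \<partial>symmetrization M) = 2 * variance (\<lambda>x. x)" .
  have "integrable M (\<lambda>x. 4 * (\<bar>x\<bar> ^ 3 + \<bar>- m\<bar> ^ 3))"
    using cube(2) by simp
  then show int_m: "integrable M (\<lambda>x. \<bar>x - m\<bar> ^ 3)"
  proof (rule Bochner_Integration.integrable_bound)
    show "AE x in M. norm (\<bar>x - m\<bar> ^ 3) \<le> norm (4 * (\<bar>x\<bar> ^ 3 + \<bar>- m\<bar> ^ 3))"
      using abs_cube_add_le[of x "- m" for x] by simp
  qed measurable
  have "expectation (\<lambda>x. \<bar>x - m\<bar> ^ 3) \<le> (\<integral>x. \<integral>y. \<bar>x - y\<bar> ^ 3 \<partial>M \<partial>M)"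
  proof (rule integral_mono_AE[OF int_m])
    show "integrable M (\<lambda>x. \<integral>y. \<bar>x - y\<bar> ^ 3 \<partial>M)"
      using pair.integrable_fst[OF cube(1)] .
    have "AE x in M. integrable M (\<lambda>y. \<bar>x - y\<bar> ^ 3)"
      using pair.AE_integrable_fst[OF cube(1)] .
    then show "AE x in M. \<bar>x - m\<bar> ^ 3 \<le> (\<integral>y. \<bar>x - y\<bar> ^ 3 \<partial>M)"
    proof eventually_elim
      fix x assume x: "integrable M (\<lambda>y. \<bar>x - y\<bar> ^ 3)"
      \<comment> \<open>Jensen's inequality for the inner integral, with the tangent taken at
        \<open>x - m\<close>: the linear term is proportional to \<open>m - y\<close> and integrates
        to 0.\<close>
      have "(\<integral>y. \<bar>x - m\<bar> ^ 3 + 3 * (x - m) * \<bar>x - m\<bar> * ((x - y) - (x - m)) \<partial>M) \<le> (\<integral>y. \<bar>x - y\<bar> ^ 3 \<partial>M)"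
        using x low by (intro integral_mono abs_cube_tangent) simp_all
      then show "\<bar>x - m\<bar> ^ 3 \<le> (\<integral>y. \<bar>x - y\<bar> ^ 3 \<partial>M)"
        using low by (simp add: prob_space m_def)
    qed
  qed
  also have "\<dots> = (\<integral>p. (case p of (x, y) \<Rightarrow> \<bar>x - y\<bar> ^ 3) \<partial>(M \<Otimes>\<^sub>M M))"
    using pair.integral_fst[OF cube(1)] .
  also have "\<dots> = (\<integral>z. \<bar>z\<bar> ^ 3 \<partial>symmetrization M)"
    unfolding symmetrization_def by (subst integral_distr) (auto simp: split_beta')
  finally show "expectation (\<lambda>x. \<bar>x - m\<bar> ^ 3) \<le> (\<integral>z. \<bar>z\<bar> ^ 3 \<partial>symmetrization M)" .
qed

end

text \<open>The squared modulus of the characteristic function of \<open>L\<close> is the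
  characteristic function of its symmetrization, so the moment bounds for the symmetrized law pass
  back to \<open>L\<close> centred at its mean.\<close>

lemma (in third_moment_measure) moments_of_root:
  assumes L: "real_distribution L" and a: "a \<ge> 0"
    and char: "\<And>t. (cmod (char L t))\<^sup>2 = exp (- (a * symbol t))"
  defines "m \<equiv> (\<integral>x. x \<partial>L)"
  shows "integrable L (\<lambda>x. x)"
    and "(\<integral>x. (x - m)\<^sup>2 \<partial>L) = a * (\<integral>x. x\<^sup>2 \<partial>F)"
    and "integrable L (\<lambda>x. \<bar>x - m\<bar> ^ 3)"
    and "(\<integral>x. \<bar>x - m\<bar> ^ 3 \<partial>L) \<le> 2 * a * (\<integral>x. \<bar>x\<bar> ^ 3 \<partial>F)
      + a\<^sup>2 * (enn2real symbol_error / (2 * enn2real cube_const))"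
proof -
  interpret L: real_distribution L by fact
  interpret symmetrized_root F "symmetrization L" a
    using L.real_distribution_symmetrization a char L.char_symmetrization third_moment_measure_axioms
    by (simp add: symmetrized_root_def symmetrized_root_axioms_def)
  note cube = third_moment(1)
  note moments = L.symmetrization_moments[OF cube, folded m_def]
  show "integrable L (\<lambda>x. x)"
    using L.integrable_cube_symmetrizationD(2)[OF cube]
    by (intro integrable_lower_moments) (auto intro: L.finite_measure_axioms)
  show "(\<integral>x. (x - m)\<^sup>2 \<partial>L) = a * (\<integral>x. x\<^sup>2 \<partial>F)"
    using moments(1) second_moment(2) by simp
  show "integrable L (\<lambda>x. \<bar>x - m\<bar> ^ 3)" by (fact moments)
  show "(\<integral>x. \<bar>x - m\<bar> ^ 3 \<partial>L) \<le> 2 * a * (\<integral>x. \<bar>x\<bar> ^ 3 \<partial>F)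
      + a\<^sup>2 * (enn2real symbol_error / (2 * enn2real cube_const))"
    using moments(3) third_moment(2) by (rule order_trans)
qed

section \<open>Normal approximation of infinitely divisible laws\<close>

lemma cdf_distr_affine:
  fixes M :: "real measure"
  assumes [measurable_cong]: "sets M = sets borel" and "s > 0"
  shows "cdf (distr M borel (\<lambda>x. m + s * x)) (m + s * y) = cdf M y"
proof -
  have "(\<lambda>x. m + s * x) -` {..m + s * y} \<inter> space M = {..y}"
    using assms(2) sets_eq_imp_space_eq[OF assms(1)] by auto
  then show ?thesis
    by (simp add: cdf_def2 measure_distr)
qed

lemma normal_cdf_affine:
  assumes "s > 0"
  shows "normal_cdf m (s\<^sup>2) (m + s * y) = normal_cdf 0 1 y"
proof -
  interpret N: prob_space std_normal_distribution
    using prob_space_normal_density by simp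
  have "distributed std_normal_distribution lborel (\<lambda>x. x) std_normal_density"
    by (simp add: distributed_def) (simp add: distr_id2)
  from N.normal_density_affine[OF this, of s m]
  have "distributed std_normal_distribution lborel (\<lambda>x. m + s * x) (normal_density m s)"
    using assms by simp
  then have "density lborel (\<lambda>x. ennreal (normal_density m s x)) = distr std_normal_distribution lborel (\<lambda>x. m + s * x)"
    by (simp add: distributed_def)
  also have "\<dots> = distr std_normal_distribution borel (\<lambda>x. m + s * x)"
    by (intro distr_cong) simp_all
  finally show ?thesis
    using assms by (simp add: normal_cdf_def cdf_distr_affine)
qed

section \<open>I.i.d. coordinates and the Berry-Esseen bound for convolution powers\<close>

lemma indep_vars_coordinates:
  fixes \<nu> :: "real measure" and I :: "'i set"
  assumes "real_distribution \<nu>"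
  shows "prob_space.indep_vars (\<Pi>\<^sub>M i\<in>I. \<nu>) (\<lambda>_. borel) (\<lambda>i \<omega>. \<omega> i) I"
    and "i \<in> I \<Longrightarrow> distr (\<Pi>\<^sub>M i\<in>I. \<nu>) borel (\<lambda>\<omega>. \<omega> i) = \<nu>"
proof -
  interpret \<nu>: real_distribution \<nu> by fact
  have [measurable_cong]: "sets \<nu> = sets borel" by simp
  interpret N: prob_space "\<Pi>\<^sub>M i\<in>I. \<nu>"
    by (intro prob_space_PiM \<nu>.prob_space_axioms)
  have law: "distr (\<Pi>\<^sub>M i\<in>I. \<nu>) borel (\<lambda>\<omega>. \<omega> i) = \<nu>" if "i \<in> I" for i
  proof -
    have "distr (\<Pi>\<^sub>M i\<in>I. \<nu>) borel (\<lambda>\<omega>. \<omega> i) = distr (\<Pi>\<^sub>M i\<in>I. \<nu>) \<nu> (\<lambda>\<omega>. \<omega> i)"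
      by (intro distr_cong) simp_all
    then show ?thesis
      using distr_PiM_component[of I "\<lambda>_. \<nu>" i] that \<nu>.prob_space_axioms by simp
  qed
  then show "i \<in> I \<Longrightarrow> distr (\<Pi>\<^sub>M i\<in>I. \<nu>) borel (\<lambda>\<omega>. \<omega> i) = \<nu>" .
  show "N.indep_vars (\<lambda>_. borel) (\<lambda>i \<omega>. \<omega> i) I"
  proof (cases "I = {}")
    \<comment> \<open>The characterization of independence by product laws is applied to nonempty
      index sets, so the empty family is treated directly.\<close>
    case True
    then show ?thesis unfolding N.indep_vars_def N.indep_sets_def by simp
  next
    case False
    have rv: "(\<lambda>\<omega>. \<omega> i) \<in> borel_measurable (\<Pi>\<^sub>M i\<in>I. \<nu>)" if "i \<in> I" for i
      using that by measurable
    have "distr (\<Pi>\<^sub>M i\<in>I. \<nu>) (\<Pi>\<^sub>M i\<in>I. borel) (\<lambda>\<omega>. \<lambda>i\<in>I. \<omega> i)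
        = distr (\<Pi>\<^sub>M i\<in>I. \<nu>) (\<Pi>\<^sub>M i\<in>I. \<nu>) (\<lambda>\<omega>. \<omega>)"
      by (intro distr_cong sets_PiM_cong) (auto simp: space_PiM)
    also have "\<dots> = (\<Pi>\<^sub>M i\<in>I. \<nu>)" by simp
    also have "\<dots> = (\<Pi>\<^sub>M i\<in>I. distr (\<Pi>\<^sub>M i\<in>I. \<nu>) borel (\<lambda>\<omega>. \<omega> i))"
      by (intro PiM_cong) (simp_all add: law)
    finally show ?thesis
      using False rv by (subst N.indep_vars_iff_distr_eq_PiM') auto
  qed
qed

lemma char_sum_coordinates:
  fixes \<nu> :: "real measure" and I J :: "'i set"
  assumes \<nu>: "real_distribution \<nu>" and "J \<subseteq> I"
  shows "char (distr (\<Pi>\<^sub>M i\<in>I. \<nu>) borel (\<lambda>\<omega>. \<Sum>i\<in>J. \<omega> i)) t = char \<nu> t ^ card J"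
proof -
  interpret \<nu>: real_distribution \<nu> by fact
  interpret N: prob_space "\<Pi>\<^sub>M i\<in>I. \<nu>"
    by (intro prob_space_PiM \<nu>.prob_space_axioms)
  have "N.indep_vars (\<lambda>_. borel) (\<lambda>i \<omega>. \<omega> i) J"
    by (rule N.indep_vars_subset[OF indep_vars_coordinates(1)[OF \<nu>] assms(2)])
  then have "char (distr (\<Pi>\<^sub>M i\<in>I. \<nu>) borel (\<lambda>\<omega>. \<Sum>i\<in>J. \<omega> i)) t
      = (\<Prod>i\<in>J. char (distr (\<Pi>\<^sub>M i\<in>I. \<nu>) borel (\<lambda>\<omega>. \<omega> i)) t)"
    by (rule N.char_distr_sum)
  also have "\<dots> = (\<Prod>i\<in>J. char \<nu> t)"
    using assms(2) by (intro prod.cong refl) (simp add: indep_vars_coordinates(2)[OF \<nu>] subset_eq)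
  finally show ?thesis by simp
qed

text \<open>The coordinates on the infinite product of copies of \<open>\<nu>\<close> form an i.i.d.
  sequence of the type demanded by \<open>berry_esseen_constant\<close>; the bound for their
  standardized sum is then carried to \<open>P\<close> by an affine change of variable.\<close>

lemma berry_esseen_convolution_power:
  fixes \<nu> P :: "real measure" and n :: nat
  assumes c: "berry_esseen_constant c" and \<nu>: "real_distribution \<nu>" and P: "real_distribution P"
    and n: "n > 0" and char: "\<And>t. char P t = char \<nu> t ^ n"
    and int: "integrable \<nu> (\<lambda>x. x)"
  defines "m \<equiv> \<integral>x. x \<partial>\<nu>"
  assumes s: "s > 0" "s\<^sup>2 = (\<integral>x. (x - m)\<^sup>2 \<partial>\<nu>)"
    and int3: "integrable \<nu> (\<lambda>x. \<bar>x - m\<bar> ^ 3)"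
  defines "\<mu> \<equiv> \<integral>x. x \<partial>P" and "\<sigma> \<equiv> s * sqrt n"
  shows "(SUP x. \<bar>cdf P x - normal_cdf \<mu> (\<sigma>\<^sup>2) x\<bar>)
    \<le> c * (\<integral>x. \<bar>x - m\<bar> ^ 3 \<partial>\<nu>) / (s ^ 3 * sqrt n)"
proof -
  interpret \<nu>: real_distribution \<nu> by fact
  have [measurable_cong]: "sets \<nu> = sets borel" by simp
  let ?N = "\<Pi>\<^sub>M i\<in>(UNIV::nat set). \<nu>" and ?Y = "\<lambda>j \<omega>. \<omega> j :: real"
  interpret N: prob_space ?N
    by (intro prob_space_PiM \<nu>.prob_space_axioms)
  define S where "S \<omega> = (\<Sum>j<n. ?Y j \<omega>)" for \<omega>
  have [measurable]: "S \<in> borel_measurable ?N" unfolding S_def by measurable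
  have law: "distr ?N borel (?Y j) = \<nu>" for j
    using indep_vars_coordinates(2)[OF \<nu>, of j UNIV] by simp
  have transfer: "(\<integral>\<omega>. f (?Y j \<omega>) \<partial>?N) = (\<integral>x. f x \<partial>\<nu>)"
    and transfer_int: "integrable ?N (\<lambda>\<omega>. f (?Y j \<omega>)) \<longleftrightarrow> integrable \<nu> f"
    if [measurable]: "f \<in> borel_measurable borel" for f :: "real \<Rightarrow> real" and j
    using integral_distr[of "?Y j" ?N borel f] integrable_distr_eq[of "?Y j" ?N borel f]
    by (simp_all add: law)
  \<comment> \<open>Only the characteristic function of \<open>P\<close> is given, so
    \<open>P\<close> is identified with the law of the sum by Levy's uniqueness theorem.\<close>
  have P_eq: "P = distr ?N borel S"
  proof (rule Levy_uniqueness[OF P])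
    show "real_distribution (distr ?N borel S)" by (rule N.real_distribution_distr) measurable
    show "char P = char (distr ?N borel S)"
      unfolding S_def[abs_def] using char_sum_coordinates[OF \<nu>, of "{..<n}" UNIV] by (simp add: fun_eq_iff char)
  qed
  have "\<mu> = (\<integral>\<omega>. S \<omega> \<partial>?N)"
    unfolding \<mu>_def P_eq by (rule integral_distr) measurable
  also have "\<dots> = (\<Sum>j<n. \<integral>\<omega>. ?Y j \<omega> \<partial>?N)"
    unfolding S_def[abs_def] by (rule Bochner_Integration.integral_sum) (simp add: transfer_int[of "\<lambda>x. x"] int)
  finally have mu: "\<mu> = real n * m"
    using transfer[of "\<lambda>x. x"] by (simp add: m_def)
  have \<sigma>: "\<sigma> > 0" using s n by (simp add: \<sigma>_def)
  define T where "T \<omega> = (S \<omega> - real n * m) / (s * sqrt n)" for \<omega>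
  have [measurable]: "T \<in> borel_measurable ?N" unfolding T_def by measurable
  have "distr (distr ?N borel T) borel (\<lambda>x. \<mu> + \<sigma> * x) = distr ?N borel S"
    using \<sigma> by (subst distr_distr) (auto intro!: distr_cong simp: o_def T_def mu \<sigma>_def)
  then have cdf_eq: "cdf P (\<mu> + \<sigma> * y) = cdf (distr ?N borel T) y" for y
    using cdf_distr_affine[of "distr ?N borel T" \<sigma> \<mu> y] \<sigma> by (simp add: P_eq)
  \<comment> \<open>The supremum can be reindexed by \<open>y\<close> because the affine map hits
    every real.\<close>
  have surj: "range (\<lambda>y. \<mu> + \<sigma> * y) = UNIV"
    by (rule surjI[of _ "\<lambda>x. (x - \<mu>) / \<sigma>"]) (use \<sigma> in simp)
  have "(SUP x. \<bar>cdf P x - normal_cdf \<mu> (\<sigma>\<^sup>2) x\<bar>)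
      = (SUP x\<in>range (\<lambda>y. \<mu> + \<sigma> * y). \<bar>cdf P x - normal_cdf \<mu> (\<sigma>\<^sup>2) x\<bar>)"
    by (simp only: surj)
  also have "\<dots> = (SUP y. \<bar>cdf (distr ?N borel T) y - normal_cdf 0 1 y\<bar>)"
    by (simp only: image_image cdf_eq normal_cdf_affine[OF \<sigma>])
  also have "\<dots> \<le> c * N.expectation (\<lambda>\<omega>. \<bar>?Y 0 \<omega> - m\<bar> ^ 3) / (s ^ 3 * sqrt (real n))"
    unfolding T_def[abs_def] S_def
    using c[unfolded berry_esseen_constant_def, THEN conjunct2, rule_format, of ?N ?Y m s n]
      N.prob_space_axioms indep_vars_coordinates(1)[OF \<nu>, of "UNIV :: nat set"] law n s int3
      transfer[of "\<lambda>x. x"] transfer[of "\<lambda>x. (x - m)\<^sup>2"] transfer_int[of "\<lambda>x. \<bar>x - m\<bar> ^ 3"]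
    by (simp add: m_def)
  also have "N.expectation (\<lambda>\<omega>. \<bar>?Y 0 \<omega> - m\<bar> ^ 3) = (\<integral>x. \<bar>x - m\<bar> ^ 3 \<partial>\<nu>)"
    by (rule transfer) measurable
  finally show ?thesis .
qed

context third_moment_measure
begin

lemma integrable_iexp_minus_1: "complex_integrable F (\<lambda>x. iexp (t * x) - 1)"
proof (rule Bochner_Integration.integrable_bound)
  show "integrable F (\<lambda>x. t * \<bar>x\<bar>)" using integrable_abs by simp
  show "AE x in F. cmod (iexp (t * x) - 1) \<le> norm (t * \<bar>x\<bar>)"
    using iexp_approx1[of "t * x" 0 for x] by (simp add: abs_mult)
qed measurable

text \<open>The modulus of an exponential depends on the real part of the exponent alone, which is
  \<open>- symbol t / 2\<close>; squaring doubles it.\<close>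

lemma cmod_char_levy:
  assumes "char P t = exp (CLINT x|F. iexp (t * x) - 1)"
  shows "(cmod (char P t))\<^sup>2 = exp (- symbol t)"
proof -
  have "Re (CLINT x|F. iexp (t * x) - 1) = (\<integral>x. cos (t * x) - 1 \<partial>F)"
    using integrable_iexp_minus_1[of t] by (subst integral_Re[symmetric]) (simp_all add: Re_exp)
  also have "\<dots> = - (symbol t / 2)"
  proof -
    have "symbol t = (\<integral>x. (- 2) * (cos (t * x) - 1) \<partial>F)"
      unfolding symbol_def by (intro Bochner_Integration.integral_cong) auto
    then show ?thesis by (simp only: integral_mult_right_zero)
  qed
  finally show ?thesis
    by (simp add: assms exp_double[symmetric])
qed

theorem infinitely_divisible_normal_approximation:
  assumes c: "berry_esseen_constant c" and P: "real_distribution P" and "infinitely_divisible P"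
    and char: "\<And>t. char P t = exp (CLINT x|F. iexp (t * x) - 1)"
    and \<sigma>: "\<sigma> > 0" "\<sigma>\<^sup>2 = (\<integral>x. (x - (\<integral>x. x \<partial>P))\<^sup>2 \<partial>P)"
  defines "\<mu> \<equiv> \<integral>x. x \<partial>P"
  shows "\<sigma>\<^sup>2 = (\<integral>x. x\<^sup>2 \<partial>F)"
    and "(SUP x. \<bar>cdf P x - normal_cdf \<mu> (\<sigma>\<^sup>2) x\<bar>) \<le> 2 * c * (\<integral>x. \<bar>x\<bar> ^ 3 \<partial>F) / \<sigma> ^ 3"
proof -
  have c0: "c > 0" using c by (simp add: berry_esseen_constant_def)
  note charP = cmod_char_levy[OF char]
  \<comment> \<open>\<open>P\<close> is its own first root, so the root lemma applies with
    \<open>a = 1\<close>.\<close>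
  show var: "\<sigma>\<^sup>2 = (\<integral>x. x\<^sup>2 \<partial>F)"
    using moments_of_root(2)[OF P, of 1] \<sigma>(2) charP by simp
  define C where "C = enn2real symbol_error / (2 * enn2real cube_const)"
  let ?\<kappa> = "\<integral>x. \<bar>x\<bar> ^ 3 \<partial>F"
  have bound: "(SUP x. \<bar>cdf P x - normal_cdf \<mu> (\<sigma>\<^sup>2) x\<bar>) \<le> c * (2 * ?\<kappa> + C * (1 / real n)) / \<sigma> ^ 3"
    if n: "n > 0" for n
  proof -
    obtain \<nu> where \<nu>: "real_distribution \<nu>"
      and P_eq: "distr (\<Pi>\<^sub>M i\<in>{..<n}. \<nu>) borel (\<lambda>\<omega>. \<Sum>i<n. \<omega> i) = P"
      using assms(3) n unfolding infinitely_divisible_def by blast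
    have pow: "char P t = char \<nu> t ^ n" for t
      using char_sum_coordinates[OF \<nu>, of "{..<n}" "{..<n}" t] by (simp add: P_eq)
    \<comment> \<open>Moduli avoid choosing a branch of the complex n-th root: nonnegative reals
      with equal n-th powers are equal.\<close>
    have root: "(cmod (char \<nu> t))\<^sup>2 = exp (- (1 / n * symbol t))" for t
    proof (rule power_eq_imp_eq_base[of _ n])
      have "((cmod (char \<nu> t))\<^sup>2) ^ n = (cmod (char P t))\<^sup>2"
        by (simp add: pow norm_power mult.commute flip: power_mult)
      also have "\<dots> = exp (- (1 / n * symbol t)) ^ n"
        using n by (simp add: charP exp_of_nat_mult[symmetric])
      finally show "((cmod (char \<nu> t))\<^sup>2) ^ n = exp (- (1 / n * symbol t)) ^ n" .
    qed (use n in simp_all)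
    define m where "m = (\<integral>x. x \<partial>\<nu>)"
    note moments = moments_of_root[OF \<nu> _ root, folded m_def C_def, simplified]
    define s where "s = \<sigma> / sqrt n"
    have s: "s > 0" "s\<^sup>2 = (\<integral>x. (x - m)\<^sup>2 \<partial>\<nu>)" and \<sigma>_eq: "s * sqrt n = \<sigma>"
      using \<sigma>(1) n moments(2) var by (auto simp: s_def power_divide)
    have "(SUP x. \<bar>cdf P x - normal_cdf \<mu> (\<sigma>\<^sup>2) x\<bar>) \<le> c * (\<integral>x. \<bar>x - m\<bar> ^ 3 \<partial>\<nu>) / (s ^ 3 * sqrt n)"
      using berry_esseen_convolution_power[OF c \<nu> P n pow moments(1) s(1), folded m_def \<mu>_def] s(2) moments(3)
      by (simp add: \<sigma>_eq)
    also have "s ^ 3 * sqrt n = \<sigma> ^ 3 / n"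
    proof -
      have "s ^ 3 * sqrt n = \<sigma> ^ 3 * (sqrt n / sqrt n ^ 3)" by (simp add: s_def power_divide)
      also have "sqrt n / sqrt n ^ 3 = 1 / n"
        using n by (simp add: eval_nat_numeral)
      finally show ?thesis by simp
    qed
    also have "c * (\<integral>x. \<bar>x - m\<bar> ^ 3 \<partial>\<nu>) / (\<sigma> ^ 3 / n) = c * (n * (\<integral>x. \<bar>x - m\<bar> ^ 3 \<partial>\<nu>)) / \<sigma> ^ 3"
      by simp
    \<comment> \<open>With \<open>a = 1 / n\<close> the main term is of order \<open>1 / n\<close>
      and the error of order \<open>1 / n\<^sup>2\<close>, so the factor \<open>n\<close> leaves
      \<open>2 * ?\<kappa>\<close> plus a vanishing term.\<close>
    also have "\<dots> \<le> c * (n * (2 * (1 / n) * ?\<kappa> + (1 / n)\<^sup>2 * C)) / \<sigma> ^ 3"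
      using moments_of_root(4)[OF \<nu> _ root, folded m_def C_def] c0 \<sigma>(1)
      by (intro divide_right_mono mult_left_mono) simp_all
    also have "n * (2 * (1 / n) * ?\<kappa> + (1 / n)\<^sup>2 * C) = 2 * ?\<kappa> + C * (1 / n)"
      using n by (simp add: field_simps power2_eq_square)
    finally show ?thesis .
  qed
  show "(SUP x. \<bar>cdf P x - normal_cdf \<mu> (\<sigma>\<^sup>2) x\<bar>) \<le> 2 * c * ?\<kappa> / \<sigma> ^ 3"
  \<comment> \<open>The left side does not depend on \<open>n\<close>, so the bound passes to the
    limit.\<close>
  proof (rule LIMSEQ_le_const)
    have "(\<lambda>n. c * (2 * ?\<kappa> + C * (1 / real n)) / \<sigma> ^ 3) \<longlonglongrightarrow> c * (2 * ?\<kappa> + C * 0) / \<sigma> ^ 3"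
      using \<sigma>(1) by (intro tendsto_intros lim_1_over_n) simp
    then show "(\<lambda>n. c * (2 * ?\<kappa> + C * (1 / real n)) / \<sigma> ^ 3) \<longlonglongrightarrow> 2 * c * ?\<kappa> / \<sigma> ^ 3"
      by (simp add: mult_ac)
    show "\<exists>N. \<forall>n\<ge>N. (SUP x. \<bar>cdf P x - normal_cdf \<mu> (\<sigma>\<^sup>2) x\<bar>) \<le> c * (2 * ?\<kappa> + C * (1 / real n)) / \<sigma> ^ 3"
      using bound by (intro exI[of _ 1]) auto
  qed
qed

end

section \<open>Means as derivatives of characteristic functions at zero\<close>

lemma integral_iexp_quotient_tendsto:
  fixes M :: "real measure" and t :: "nat \<Rightarrow> real"
  assumes [measurable_cong]: "sets M = sets borel" and int: "integrable M (\<lambda>x. x)"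
    and t: "t \<longlonglongrightarrow> 0" and t_nz: "\<And>k. t k \<noteq> 0"
  shows "(\<lambda>k. (CLINT x|M. iexp (t k * x) - 1) / of_real (t k)) \<longlonglongrightarrow> \<i> * of_real (\<integral>x. x \<partial>M)"
proof -
  have "(\<lambda>k. CLINT x|M. (iexp (t k * x) - 1) / of_real (t k)) \<longlonglongrightarrow> (CLINT x|M. \<i> * of_real x)"
  proof (rule integral_dominated_convergence[where w = "\<lambda>x. \<bar>x\<bar>"])
    show "AE x in M. (\<lambda>k. (iexp (t k * x) - 1) / of_real (t k)) \<longlonglongrightarrow> \<i> * of_real x"
    proof (rule AE_I2, rule LIM_zero_cancel)
      fix x
      \<comment> \<open>Pointwise convergence at rate \<open>\<bar>t k\<bar>\<close>, from the
        first-order Taylor error of \<open>iexp\<close>. The bound is not uniform in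
        \<open>x\<close>, hence the separate majorant \<open>\<bar>x\<bar>\<close> below.\<close>
      have "cmod ((iexp (t k * x) - 1) / of_real (t k) - \<i> * of_real x) \<le> \<bar>t k\<bar> * (x\<^sup>2 / 2)" for k
      proof -
        have "(iexp (t k * x) - 1) / of_real (t k) - \<i> * of_real x
            = (iexp (t k * x) - (\<Sum>j\<le>1. (\<i> * (t k * x)) ^ j / fact j)) / of_real (t k)"
          using t_nz[of k] by (simp add: field_simps)
        then have "cmod ((iexp (t k * x) - 1) / of_real (t k) - \<i> * of_real x)
            \<le> (\<bar>t k * x\<bar>\<^sup>2 / 2) / \<bar>t k\<bar>"
          using iexp_approx1[of "t k * x" 1]
          by (simp only: norm_divide norm_of_real) (intro divide_right_mono, simp_all add: numeral_2_eq_2)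
        also have "\<dots> = \<bar>t k\<bar> * (x\<^sup>2 / 2)"
          using t_nz[of k] by (simp add: abs_mult power_mult_distrib power2_eq_square)
        finally show ?thesis .
      qed
      moreover have "(\<lambda>k. \<bar>t k\<bar> * (x\<^sup>2 / 2)) \<longlonglongrightarrow> 0"
        using tendsto_mult[OF tendsto_rabs[OF t] tendsto_const[of "x\<^sup>2 / 2"]] by simp
      ultimately show "(\<lambda>k. (iexp (t k * x) - 1) / of_real (t k) - \<i> * of_real x) \<longlonglongrightarrow> 0"
        by (rule Lim_null_comparison[OF always_eventually, OF allI])
    qed
    show "AE x in M. cmod ((iexp (t k * x) - 1) / of_real (t k)) \<le> \<bar>x\<bar>" for k
    proof (intro AE_I2)
      fix x
      have "cmod (iexp (t k * x) - 1) \<le> \<bar>x\<bar> * \<bar>t k\<bar>"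
        using iexp_approx1[of "t k * x" 0] by (simp add: abs_mult mult.commute)
      then show "cmod ((iexp (t k * x) - 1) / of_real (t k)) \<le> \<bar>x\<bar>"
        using t_nz[of k] by (simp add: norm_divide divide_le_eq)
    qed
    show "integrable M (\<lambda>x. \<bar>x\<bar>)"
      using int by (rule integrable_abs)
  qed measurable
  then show ?thesis by simp
qed

text \<open>The difference quotient of the characteristic function at 0 is computed twice: directly,
  and through the exponent by the chain rule. Its limit is \<open>\<i>\<close> times either
  mean.\<close>

lemma (in third_moment_measure) mean_levy:
  assumes P: "real_distribution P" and int: "integrable P (\<lambda>x. x)"
    and char: "\<And>t. char P t = exp (CLINT x|F. iexp (t * x) - 1)"
  shows "(\<integral>x. x \<partial>P) = (\<integral>x. x \<partial>F)"
proof -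
  interpret P: real_distribution P by fact
  define t where "t k = inverse (real (Suc k))" for k
  have t: "t \<longlonglongrightarrow> 0" and t_nz: "t k \<noteq> 0" for k
    unfolding t_def using LIMSEQ_inverse_real_of_nat by simp_all
  define w where "w k = (CLINT x|F. iexp (t k * x) - 1)" for k
  have int_F: "integrable F (\<lambda>x. x)"
    by (rule integrable_abs_cancel[OF integrable_abs]) measurable
  have w_quot: "(\<lambda>k. w k / of_real (t k)) \<longlonglongrightarrow> \<i> * of_real (\<integral>x. x \<partial>F)"
    unfolding w_def by (rule integral_iexp_quotient_tendsto[OF sets_F int_F t t_nz])
  have "(\<lambda>k. w k / of_real (t k) * of_real (t k)) \<longlonglongrightarrow> \<i> * of_real (\<integral>x. x \<partial>F) * of_real 0"
    by (intro tendsto_mult w_quot tendsto_of_real t)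
  then have w: "w \<longlonglongrightarrow> 0" using t_nz by simp
  \<comment> \<open>Caratheodory's form of \<open>exp' 0 = 1\<close> avoids a division by
    \<open>w k\<close>, which might be 0.\<close>
  obtain g where g: "\<And>z. exp z - exp 0 = g z * (z - 0)" "isCont g 0" "g 0 = (1::complex)"
    using DERIV_exp[of "0::complex"] unfolding CARAT_DERIV exp_zero by auto
  have "(\<lambda>k. g (w k)) \<longlonglongrightarrow> 1"
    using isCont_tendsto_compose[OF g(2) w] g(3) by simp
  then have "(\<lambda>k. g (w k) * (w k / of_real (t k))) \<longlonglongrightarrow> 1 * (\<i> * of_real (\<integral>x. x \<partial>F))"
    by (intro tendsto_mult w_quot)
  moreover have "(CLINT x|P. iexp (t k * x) - 1) / of_real (t k) = g (w k) * (w k / of_real (t k))" for k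
  proof -
    have "(CLINT x|P. iexp (t k * x) - 1) = char P (t k) - 1"
      unfolding char_def using P.prob_space
      by (subst Bochner_Integration.integral_diff) (auto intro: P.integrable_iexp)
    also have "\<dots> = g (w k) * w k"
      using g(1)[of "w k"] by (simp add: char w_def)
    finally show ?thesis by simp
  qed
  ultimately have "(\<lambda>k. (CLINT x|P. iexp (t k * x) - 1) / of_real (t k)) \<longlonglongrightarrow> \<i> * of_real (\<integral>x. x \<partial>F)"
    by (simp only: mult_1)
  moreover have "(\<lambda>k. (CLINT x|P. iexp (t k * x) - 1) / of_real (t k)) \<longlonglongrightarrow> \<i> * of_real (\<integral>x. x \<partial>P)"
    by (rule integral_iexp_quotient_tendsto[OF _ int t t_nz]) simp
  ultimately have "\<i> * complex_of_real (\<integral>x. x \<partial>F) = \<i> * of_real (\<integral>x. x \<partial>P)"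
    by (rule LIMSEQ_unique)
  then show ?thesis by simp
qed

section \<open>Tempered stable laws\<close>

definition ts_moment :: "real \<Rightarrow> real \<Rightarrow> real \<Rightarrow> nat \<Rightarrow> real" where
  "ts_moment \<alpha> \<beta> l k = \<alpha> * Gamma (k - \<beta>) / l powr (k - \<beta>)"

definition ts_half_density :: "real \<Rightarrow> real \<Rightarrow> real \<Rightarrow> real \<Rightarrow> real" where
  "ts_half_density \<alpha> \<beta> l x = \<alpha> / x powr (1 + \<beta>) * exp (- l * x) * indicator {0<..} x"

text \<open>Up to the scaling \<open>l * x\<close>, this is Euler's integral for Gamma at
  \<open>k - \<beta>\<close>; the condition \<open>k > \<beta>\<close> gives convergence at the
  origin.\<close>

lemma has_bochner_integral_ts_half_density:
  assumes "l > 0" and "real k > \<beta>"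
  shows "has_bochner_integral lborel (\<lambda>x. x ^ k * ts_half_density \<alpha> \<beta> l x) (ts_moment \<alpha> \<beta> l k)"
proof -
  define s where "s = k - \<beta>"
  have s: "s > 0" using assms by (simp add: s_def)
  let ?f = "\<lambda>t::real. indicator {0..} t * t powr (s - 1) / exp t"
  have "has_bochner_integral lborel ?f (Gamma s)"
    using Gamma_conv_nn_integral_real[OF s] s Gamma_real_pos[OF s]
    by (intro has_bochner_integral_nn_integral) auto
  then have "has_bochner_integral lborel (\<lambda>x. ?f (0 + l * x)) (Gamma s /\<^sub>R \<bar>l\<bar>)"
    using assms(1) by (subst (asm) lborel_has_bochner_integral_real_affine_iff[where c = l and t = 0]) simp_all
  \<comment> \<open>The factor \<open>l powr (1 - s)\<close> cancels the power of \<open>l\<close>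
    hidden in \<open>(l * x) powr (s - 1)\<close>.\<close>
  then have "has_bochner_integral lborel (\<lambda>x. \<alpha> * l powr (1 - s) * ?f (0 + l * x)) (\<alpha> * l powr (1 - s) * (Gamma s /\<^sub>R \<bar>l\<bar>))"
    by (intro has_bochner_integral_mult_right)
  also have "\<alpha> * l powr (1 - s) * (Gamma s /\<^sub>R \<bar>l\<bar>) = ts_moment \<alpha> \<beta> l k"
    using assms(1) by (simp add: ts_moment_def s_def[symmetric] powr_diff field_simps)
  also have "(\<lambda>x. \<alpha> * l powr (1 - s) * ?f (0 + l * x)) = (\<lambda>x. x ^ k * ts_half_density \<alpha> \<beta> l x)"
  proof
    fix x
    show "\<alpha> * l powr (1 - s) * ?f (0 + l * x) = x ^ k * ts_half_density \<alpha> \<beta> l x"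
    proof (cases "x > 0")
      case True
      have "l powr (1 - s) * (l * x) powr (s - 1) = x powr (s - 1)"
        using True assms(1) by (simp add: powr_mult powr_add[symmetric] flip: mult.assoc)
      also have "\<dots> = x ^ k / x powr (1 + \<beta>)"
        using True by (simp add: s_def powr_diff powr_add powr_realpow)
      finally show ?thesis
        using True assms(1) by (simp add: ts_half_density_def exp_minus field_simps)
    next
      case False
      \<comment> \<open>\<open>0 powr a = 0\<close> for every exponent, so the endpoint of \<open>{0..}\<close> contributes nothing\<close>
      then have "x = 0 \<or> l * x < 0" using assms(1) by (auto simp: mult_less_0_iff)
      then show ?thesis
        using False by (auto simp: ts_half_density_def)
    qed
  qed
  finally show ?thesis .
qed

lemma ts_moment_Suc:
  assumes "l > 0" and "real k > \<beta>"
  shows "ts_moment \<alpha> \<beta> l (Suc k) = (k - \<beta>) * ts_moment \<alpha> \<beta> l k / l"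
proof -
  have "Gamma (real (Suc k) - \<beta>) = (k - \<beta>) * Gamma (k - \<beta>)"
    using Gamma_plus1[of "real k - \<beta>"] assms by (simp add: nonpos_Ints_def algebra_simps)
  moreover have "l powr (real (Suc k) - \<beta>) = l powr (k - \<beta>) * l"
    using assms by (simp add: powr_add[symmetric] powr_mult_base algebra_simps)
  ultimately show ?thesis
    by (simp add: ts_moment_def mult_ac)
qed

section \<open>Moments of the two-sided tempered stable Levy measure\<close>

context
  fixes \<alpha>_p \<beta>_p lam_p \<alpha>_m \<beta>_m lam_m :: real
  assumes pos: "\<alpha>_p > 0" "lam_p > 0" "\<alpha>_m > 0" "lam_m > 0" and \<beta>: "\<beta>_p < 1" "\<beta>_m < 1"
begin

abbreviation "levy \<equiv> ts_levy_measure \<alpha>_p \<beta>_p lam_p \<alpha>_m \<beta>_m lam_m"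
abbreviation "levy_density \<equiv> ts_levy_density \<alpha>_p \<beta>_p lam_p \<alpha>_m \<beta>_m lam_m"

lemma levy_density_eq:
  "levy_density x = ts_half_density \<alpha>_p \<beta>_p lam_p x + ts_half_density \<alpha>_m \<beta>_m lam_m (- x)"
  by (auto simp: ts_levy_density_def ts_half_density_def indicator_def)

lemma levy_density_nonneg: "levy_density x \<ge> 0"
  using pos by (simp add: levy_density_eq ts_half_density_def)

lemma measurable_levy_density [measurable]: "levy_density \<in> borel_measurable borel"
  unfolding ts_levy_density_def[abs_def] by measurable

text \<open>The constant \<open>c\<close> records parity: 1 for even powers and for
  \<open>\<bar>x\<bar> ^ 3\<close>, -1 for the identity. The value of \<open>f\<close> at 0 is free
  because the density vanishes there.\<close>

lemma has_bochner_integral_levy: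
  assumes [measurable]: "f \<in> borel_measurable borel" and k: "k \<ge> 1"
    and f: "\<And>x. x > 0 \<Longrightarrow> f x = x ^ k" "\<And>x. x > 0 \<Longrightarrow> f (- x) = c * x ^ k"
  shows "has_bochner_integral levy f (ts_moment \<alpha>_p \<beta>_p lam_p k + c * ts_moment \<alpha>_m \<beta>_m lam_m k)"
  unfolding ts_levy_measure_def
proof (rule has_bochner_integral_density)
  have k\<beta>: "real k > \<beta>_p" "real k > \<beta>_m" using k \<beta> by linarith+
  \<comment> \<open>The negative half-line is reflected by the affine rule with slope -1 and shift
    0.\<close>
  have "has_bochner_integral lborel (\<lambda>x. (0 + - 1 * x) ^ k * ts_half_density \<alpha>_m \<beta>_m lam_m (0 + - 1 * x))
      (ts_moment \<alpha>_m \<beta>_m lam_m k /\<^sub>R \<bar>- 1\<bar>)"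
    by (subst lborel_has_bochner_integral_real_affine_iff[symmetric])
       (use pos k\<beta> in \<open>auto intro: has_bochner_integral_ts_half_density\<close>)
  then have "has_bochner_integral lborel (\<lambda>x. c * ((- x) ^ k * ts_half_density \<alpha>_m \<beta>_m lam_m (- x)))
      (c * ts_moment \<alpha>_m \<beta>_m lam_m k)"
    by (intro has_bochner_integral_mult_right) simp
  then have "has_bochner_integral lborel
      (\<lambda>x. x ^ k * ts_half_density \<alpha>_p \<beta>_p lam_p x + c * ((- x) ^ k * ts_half_density \<alpha>_m \<beta>_m lam_m (- x)))
      (ts_moment \<alpha>_p \<beta>_p lam_p k + c * ts_moment \<alpha>_m \<beta>_m lam_m k)"
    by (intro has_bochner_integral_add has_bochner_integral_ts_half_density pos k\<beta>)
  moreover have "x ^ k * ts_half_density \<alpha>_p \<beta>_p lam_p x + c * ((- x) ^ k * ts_half_density \<alpha>_m \<beta>_m lam_m (- x))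
      = levy_density x *\<^sub>R f x" for x
    using f(1)[of x] f(2)[of "- x"]
    by (cases "x > 0"; cases "x < 0") (auto simp: levy_density_eq ts_half_density_def)
  ultimately show "has_bochner_integral lborel (\<lambda>x. levy_density x *\<^sub>R f x)
      (ts_moment \<alpha>_p \<beta>_p lam_p k + c * ts_moment \<alpha>_m \<beta>_m lam_m k)"
    by simp
qed (use levy_density_nonneg in auto)

lemma levy_moments:
  shows "has_bochner_integral levy (\<lambda>x. x) (ts_moment \<alpha>_p \<beta>_p lam_p 1 - ts_moment \<alpha>_m \<beta>_m lam_m 1)"
    and "has_bochner_integral levy (\<lambda>x. x\<^sup>2) (ts_moment \<alpha>_p \<beta>_p lam_p 2 + ts_moment \<alpha>_m \<beta>_m lam_m 2)"
    and "has_bochner_integral levy (\<lambda>x. \<bar>x\<bar> ^ 3) (ts_moment \<alpha>_p \<beta>_p lam_p 3 + ts_moment \<alpha>_m \<beta>_m lam_m 3)"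
proof -
  have "has_bochner_integral levy (\<lambda>x. x) (ts_moment \<alpha>_p \<beta>_p lam_p 1 + - 1 * ts_moment \<alpha>_m \<beta>_m lam_m 1)"
    by (rule has_bochner_integral_levy) auto
  then show "has_bochner_integral levy (\<lambda>x. x) (ts_moment \<alpha>_p \<beta>_p lam_p 1 - ts_moment \<alpha>_m \<beta>_m lam_m 1)"
    by simp
  have "has_bochner_integral levy (\<lambda>x. x\<^sup>2) (ts_moment \<alpha>_p \<beta>_p lam_p 2 + 1 * ts_moment \<alpha>_m \<beta>_m lam_m 2)"
    by (rule has_bochner_integral_levy) auto
  then show "has_bochner_integral levy (\<lambda>x. x\<^sup>2) (ts_moment \<alpha>_p \<beta>_p lam_p 2 + ts_moment \<alpha>_m \<beta>_m lam_m 2)"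
    by simp
  have "has_bochner_integral levy (\<lambda>x. \<bar>x\<bar> ^ 3) (ts_moment \<alpha>_p \<beta>_p lam_p 3 + 1 * ts_moment \<alpha>_m \<beta>_m lam_m 3)"
    by (rule has_bochner_integral_levy) auto
  then show "has_bochner_integral levy (\<lambda>x. \<bar>x\<bar> ^ 3) (ts_moment \<alpha>_p \<beta>_p lam_p 3 + ts_moment \<alpha>_m \<beta>_m lam_m 3)"
    by simp
qed

lemma third_moment_measure_levy: "third_moment_measure levy"
proof -
  have "sigma_finite_measure levy"
    unfolding ts_levy_measure_def
    by (subst sigma_finite_measure.sigma_finite_iff_density_finite[OF sigma_finite_lborel]) auto
  moreover have "sets levy = sets borel"
    by (simp add: ts_levy_measure_def)
  ultimately show ?thesis
    using levy_moments unfolding third_moment_measure_def third_moment_measure_axioms_def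
    by (auto simp: has_bochner_integral_iff)
qed

end

section \<open>Eliminating the half-line moments in favour of mean and variance\<close>

theorem theorem4p7:
  fixes M :: "'a measure" and X :: "'a \<Rightarrow> real"
    and \<alpha>_p \<beta>_p lam_p \<alpha>_m \<beta>_m lam_m \<mu> \<sigma> c :: real
  assumes "berry_esseen_constant c"
    and "\<alpha>_p > 0" and "lam_p > 0" and "\<alpha>_m > 0" and "lam_m > 0"
    and "\<beta>_p \<in> {0..<1}" and "\<beta>_m \<in> {0..<1}"
    and "prob_space M" and "X \<in> borel_measurable M"
    and "is_tempered_stable \<alpha>_p \<beta>_p lam_p \<alpha>_m \<beta>_m lam_m (distr M borel X)"
    and "\<mu> = prob_space.expectation M X"
    and "\<sigma>\<^sup>2 = prob_space.variance M X" and "\<sigma> > 0"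
  shows "(SUP x. \<bar>cdf (distr M borel X) x - normal_cdf \<mu> (\<sigma>\<^sup>2) x\<bar>)
    \<le> 32 * c *
      ( (1 - \<beta>_p) * (2 - \<beta>_p) * (((1 - \<beta>_m) * \<mu> / \<sigma> ^ 3 + lam_m / \<sigma>)
          / (lam_p * ((1 - \<beta>_m) * lam_p + (1 - \<beta>_p) * lam_m)))
      + (1 - \<beta>_m) * (2 - \<beta>_m) * (((\<beta>_p - 1) * \<mu> / \<sigma> ^ 3 + lam_p / \<sigma>)
          / (lam_m * ((1 - \<beta>_m) * lam_p + (1 - \<beta>_p) * lam_m))))"
proof -
  let ?F = "ts_levy_measure \<alpha>_p \<beta>_p lam_p \<alpha>_m \<beta>_m lam_m" and ?P = "distr M borel X"
  interpret M: prob_space M by fact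
  have \<beta>: "\<beta>_p < 1" "\<beta>_m < 1" and c: "c > 0"
    using assms(1,6,7) by (auto simp: berry_esseen_constant_def)
  note [measurable] = \<open>X \<in> borel_measurable M\<close>
  interpret F: third_moment_measure ?F
    by (rule third_moment_measure_levy) (use assms(2-5) \<beta> in auto)
  have P: "real_distribution ?P" "infinitely_divisible ?P"
    and char: "char ?P t = exp (CLINT x|?F. iexp (t * x) - 1)" for t
    using assms(10) by (auto simp: is_tempered_stable_def)
  have mean: "(\<integral>x. x \<partial>?P) = \<mu>" and var: "\<sigma>\<^sup>2 = (\<integral>x. (x - (\<integral>x. x \<partial>?P))\<^sup>2 \<partial>?P)"
    using assms(11,12) by (simp_all add: integral_distr)
  note approx = F.infinitely_divisible_normal_approximation[OF assms(1) P char assms(13) var, unfolded mean]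
  \<comment> \<open>The expectation of a non-integrable variable would default to 0, so
    integrability is established before \<open>\<mu>\<close> is compared with the first moment of
    the Levy measure.\<close>
  have int_P: "integrable ?P (\<lambda>x. x)"
    using F.moments_of_root(1)[OF P(1), of 1] F.cmod_char_levy[OF char] by simp
  define A where "A = ts_moment \<alpha>_p \<beta>_p lam_p 1"
  define B where "B = ts_moment \<alpha>_m \<beta>_m lam_m 1"
  \<comment> \<open>The Gamma recursion expresses all moments through the first ones,
    \<open>A\<close> and \<open>B\<close>, so no Gamma values remain.\<close>
  have moments_p: "ts_moment \<alpha>_p \<beta>_p lam_p 2 = (1 - \<beta>_p) * A / lam_p"
      "ts_moment \<alpha>_p \<beta>_p lam_p 3 = (2 - \<beta>_p) * ((1 - \<beta>_p) * A / lam_p) / lam_p"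
    using ts_moment_Suc[of lam_p \<beta>_p 1 \<alpha>_p] ts_moment_Suc[of lam_p \<beta>_p 2 \<alpha>_p] assms(3) \<beta>
    by (simp_all add: A_def eval_nat_numeral)
  have moments_m: "ts_moment \<alpha>_m \<beta>_m lam_m 2 = (1 - \<beta>_m) * B / lam_m"
      "ts_moment \<alpha>_m \<beta>_m lam_m 3 = (2 - \<beta>_m) * ((1 - \<beta>_m) * B / lam_m) / lam_m"
    using ts_moment_Suc[of lam_m \<beta>_m 1 \<alpha>_m] ts_moment_Suc[of lam_m \<beta>_m 2 \<alpha>_m] assms(5) \<beta>
    by (simp_all add: B_def eval_nat_numeral)
  note levy = levy_moments[OF assms(2-5) \<beta>, THEN has_bochner_integral_integral_eq]
  have mu: "\<mu> = A - B"
    using F.mean_levy[OF P(1) int_P char] levy(1) by (simp add: mean A_def B_def)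
  have sigma: "\<sigma>\<^sup>2 = (1 - \<beta>_p) * A / lam_p + (1 - \<beta>_m) * B / lam_m"
    using approx(1) levy(2) by (simp add: moments_p moments_m)
  define K where "K = (2 - \<beta>_p) * ((1 - \<beta>_p) * A / lam_p) / lam_p
    + (2 - \<beta>_m) * ((1 - \<beta>_m) * B / lam_m) / lam_m"
  have K: "(\<integral>x. \<bar>x\<bar> ^ 3 \<partial>?F) = K"
    using levy(3) by (simp add: K_def moments_p moments_m)
  have "K \<ge> 0"
    unfolding K[symmetric] by (intro integral_nonneg_AE) simp
  define D where "D = (1 - \<beta>_m) * lam_p + (1 - \<beta>_p) * lam_m"
  have D: "D > 0"
    unfolding D_def using assms(3,5) \<beta> by (intro add_pos_pos mult_pos_pos) auto
  \<comment> \<open>Cramer's rule for the linear system \<open>mu\<close>, \<open>sigma\<close> in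
    the unknowns \<open>A\<close> and \<open>B\<close>; its determinant is
    \<open>D / (lam_p * lam_m)\<close>.\<close>
  have sol_A: "(1 - \<beta>_m) * \<mu> + lam_m * \<sigma>\<^sup>2 = A * D / lam_p"
    and sol_B: "(\<beta>_p - 1) * \<mu> + lam_p * \<sigma>\<^sup>2 = B * D / lam_m"
    unfolding mu sigma D_def using assms(3,5) by (simp_all add: field_simps)
  have split: "x * \<mu> / \<sigma> ^ 3 + y / \<sigma> = (x * \<mu> + y * \<sigma>\<^sup>2) / \<sigma> ^ 3" for x y
    using assms(13) by (simp add: field_simps eval_nat_numeral)
  have quot_p: "((1 - \<beta>_m) * \<mu> / \<sigma> ^ 3 + lam_m / \<sigma>) / (lam_p * D) = A / lam_p\<^sup>2 / \<sigma> ^ 3"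
    unfolding split sol_A using assms(3,13) D by (simp add: field_simps power2_eq_square)
  have quot_m: "((\<beta>_p - 1) * \<mu> / \<sigma> ^ 3 + lam_p / \<sigma>) / (lam_m * D) = B / lam_m\<^sup>2 / \<sigma> ^ 3"
    unfolding split sol_B using assms(5,13) D by (simp add: field_simps power2_eq_square)
  have "(SUP x. \<bar>cdf ?P x - normal_cdf \<mu> (\<sigma>\<^sup>2) x\<bar>) \<le> 2 * c * K / \<sigma> ^ 3"
    using approx(2) unfolding K .
  \<comment> \<open>The argument yields the constant 2, and \<open>K \<ge> 0\<close> allows
    enlarging it to the stated 32.\<close>
  also have "\<dots> \<le> 32 * c * K / \<sigma> ^ 3"
    using c \<open>K \<ge> 0\<close> assms(13) by (intro divide_right_mono mult_right_mono) simp_all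
  also have "\<dots> = 32 * c * ((1 - \<beta>_p) * (2 - \<beta>_p) * (A / lam_p\<^sup>2 / \<sigma> ^ 3)
      + (1 - \<beta>_m) * (2 - \<beta>_m) * (B / lam_m\<^sup>2 / \<sigma> ^ 3))"
  proof -
    have "K = (1 - \<beta>_p) * (2 - \<beta>_p) * (A / lam_p\<^sup>2) + (1 - \<beta>_m) * (2 - \<beta>_m) * (B / lam_m\<^sup>2)"
      by (simp add: K_def power2_eq_square mult_ac)
    then show ?thesis
      by (simp add: add_divide_distrib distrib_left)
  qed
  finally show ?thesis
    unfolding D_def[symmetric] quot_p quot_m .
qed

end
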